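(* Let $n\ge 1$, $m\ge 2$ and $k\ge 3$ be integers, and let $G=B(n,n,mP_k)$ be the strong double broom with $n$ leaves at each hub vertex and $m$ internally vertex disjoint hub-to-hub paths on $k$ vertices. Then $$dern(G)=\begin{cases}1 & \text{if } n+m\ge 6, \text{ or if } n+m<6,\ (n,m)\ne(1,2),(1,3) \text{ and } k=3,\\ 2 & \text{otherwise.}\end{cases}$$
   Context: All graphs are finite, simple and undirected. For an edge $e$ of a graph $G$, the degree $d(e)$ of $e$ is the number of edges of $G$ adjacent to $e$ (sharing an end with $e$). A degree associated edge card (da-ecard) of $G$ is the pair $(d(e),G-e)$, where $G-e$ is considered as an unlabeled graph; the da-edeck of $G$ is the multiset of all its da-ecards (one for each edge). The degree associated edge reconstruction number $dern(G)$ is the size of the smallest sub-multiset of the da-edeck of $G$ that is not contained in the da-edeck of any graph $H$ with $H\not\cong G$. A strong double broom is a graph on at least 5 vertices obtained from a union of at least two internally vertex disjoint paths with the same ends $u$ and $v$ (the hub vertices) by appending leaves (pendant vertices) at $u$ and at $v$. In general $B(n_1,n_2,m_1P_{k_1},\dots,m_tP_{k_t})$ (with $k_1<k_2<\dots<k_t$, $m_i\ge 0$) denotes the strong double broom with $n_1$ leaves attached to $u$, $n_2$ leaves attached to $v$, and, for each $i$, exactly $m_i$ internally vertex disjoint $(u,v)$-paths on $k_i$ vertices; $B(n,n,mP_k)$ is the case $n_1=n_2=n$, $t=1$, $m_1=m$, $k_1=k$. *)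

theory Defs
  imports "HOL-Library.Multiset"
begin

record 'a ugraph =
  verts :: "'a set"
  edges :: "'a set set"

definition simple_graph :: "'a ugraph \<Rightarrow> bool" where
  "simple_graph G \<longleftrightarrow> finite (verts G) \<and> (\<forall>e \<in> edges G. e \<subseteq> verts G \<and> card e = 2)"

definition graph_iso :: "'a ugraph \<Rightarrow> 'b ugraph \<Rightarrow> bool" where
  "graph_iso G H \<longleftrightarrow>
     (\<exists>f. bij_betw f (verts G) (verts H) \<and>
          (\<forall>u \<in> verts G. \<forall>v \<in> verts G. {u, v} \<in> edges G \<longleftrightarrow> {f u, f v} \<in> edges H))"

definition edge_degree :: "'a ugraph \<Rightarrow> 'a set \<Rightarrow> nat" where
  "edge_degree G e = card {f \<in> edges G. f \<noteq> e \<and> f \<inter> e \<noteq> {}}"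

definition delete_edge :: "'a ugraph \<Rightarrow> 'a set \<Rightarrow> 'a ugraph" where
  "delete_edge G e = G\<lparr>edges := edges G - {e}\<rparr>"

(* Every finite graph is isomorphic to one whose vertices are natural numbers, so the
   isomorphism class is represented by its members of type nat ugraph.  This also makes
   unlabeled graphs of differently typed labeled graphs comparable by equality. *)
definition unlabeled :: "'a ugraph \<Rightarrow> nat ugraph set" where
  "unlabeled G = {H. simple_graph H \<and> graph_iso G H}"

definition da_ecard :: "'a ugraph \<Rightarrow> 'a set \<Rightarrow> nat \<times> nat ugraph set" where
  "da_ecard G e = (edge_degree G e, unlabeled (delete_edge G e))"

definition da_edeck :: "'a ugraph \<Rightarrow> (nat \<times> nat ugraph set) multiset" where
  "da_edeck G = image_mset (da_ecard G) (mset_set (edges G))"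

(* For the same reason it suffices to let H range over graphs on natural numbers. *)
definition determines :: "(nat \<times> nat ugraph set) multiset \<Rightarrow> 'a ugraph \<Rightarrow> bool" where
  "determines S G \<longleftrightarrow>
     S \<subseteq># da_edeck G \<and>
     (\<forall>H :: nat ugraph. simple_graph H \<and> \<not> graph_iso H G \<longrightarrow> \<not> S \<subseteq># da_edeck H)"

(* Unspecified if not even the whole da-edeck determines G. *)
definition dern :: "'a ugraph \<Rightarrow> nat" where
  "dern G = (LEAST s. \<exists>S. determines S G \<and> size S = s)"

datatype broom_vertex = HubU | HubV | LeafU nat | LeafV nat | Inner nat nat

(* The vertex at position l (0 \<le> l < k) of the j-th hub-to-hub path, on k vertices. *)
definition path_vertex :: "nat \<Rightarrow> nat \<Rightarrow> nat \<Rightarrow> broom_vertex" where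
  "path_vertex k j l = (if l = 0 then HubU else if Suc l = k then HubV else Inner j l)"

(* One path for each entry of ks; the entry is the number of vertices of that path,
   hubs included. *)
definition broom_of_paths :: "nat \<Rightarrow> nat \<Rightarrow> nat list \<Rightarrow> broom_vertex ugraph" where
  "broom_of_paths n1 n2 ks =
     \<lparr>verts = {HubU, HubV} \<union> LeafU ` {..<n1} \<union> LeafV ` {..<n2} \<union>
        {path_vertex (ks ! j) j l | j l. j < length ks \<and> l < ks ! j},
      edges = {{HubU, LeafU i} | i. i < n1} \<union> {{HubV, LeafV i} | i. i < n2} \<union>
        {{path_vertex (ks ! j) j l, path_vertex (ks ! j) j (Suc l)} | j l.
           j < length ks \<and> Suc l < ks ! j}\<rparr>"

(* B(n1, n2, m_1 P_{k_1}, ..., m_t P_{k_t}), with the list [(m_1, k_1), ..., (m_t, k_t)]. *)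
definition strong_double_broom ::
  "nat \<Rightarrow> nat \<Rightarrow> (nat \<times> nat) list \<Rightarrow> broom_vertex ugraph" where
  "strong_double_broom n1 n2 mks =
     broom_of_paths n1 n2 (concat (map (\<lambda>(m, k). replicate m k) mks))"

end

theory Submission
  imports Defs
begin

text \<open>
  The card of an edge \<open>e\<close> lies in the deck of \<open>H\<close> iff \<open>H\<close> arises from \<open>G - e\<close> by joining two
  nonadjacent vertices whose degrees in \<open>G - e\<close> add up to \<open>d(e)\<close>. In a broom the degrees are
  \<open>1\<close>, \<open>2\<close> and \<open>n + m\<close>, so there are few such pairs. For \<open>n + m \<ge> 6\<close> the card of a pendant edge
  leaves only the removed edge. For \<open>k = 3\<close> the card of an edge at a hub leaves, apart from the two smallest
  exceptions, only the pairs formed by that hub and a leaf of the other hub, and these leaves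
  are twins. In all other cases every card has a second extension. Two cards then suffice: apart
  from \<open>n + m = 3\<close>, a wrong extension of a pendant card keeps an isolated vertex, which
  no card of a path edge has. For \<open>n + m = 3\<close> the wrong extensions are the cycles with two
  pendant edges at vertices that are not antipodal, and a second card excludes them.
\<close>

section \<open>Decks and extensions of cards\<close>

definition nbrs :: "'a ugraph \<Rightarrow> 'a \<Rightarrow> 'a set" where
  "nbrs G x = {y. {x, y} \<in> edges G}"

definition add_edge :: "'a ugraph \<Rightarrow> 'a set \<Rightarrow> 'a ugraph" where
  "add_edge G e = G\<lparr>edges := insert e (edges G)\<rparr>"

definition iso_map :: "('a \<Rightarrow> 'b) \<Rightarrow> 'a ugraph \<Rightarrow> 'b ugraph \<Rightarrow> bool" where
  "iso_map f G H \<longleftrightarrow> bij_betw f (verts G) (verts H) \<and>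
     (\<forall>u \<in> verts G. \<forall>v \<in> verts G. {u, v} \<in> edges G \<longleftrightarrow> {f u, f v} \<in> edges H)"

section \<open>Isomorphisms and neighbourhoods\<close>

lemma graph_iso_iff: "graph_iso G H \<longleftrightarrow> (\<exists>f. iso_map f G H)"
  by (simp add: graph_iso_def iso_map_def)

lemma iso_map_id: "iso_map id G G"
  by (simp add: iso_map_def)

lemma iso_map_comp:
  assumes "iso_map f G H" "iso_map g H K"
  shows "iso_map (g \<circ> f) G K"
  using assms unfolding iso_map_def
  by (auto intro: bij_betw_trans simp: bij_betw_apply)

lemma iso_map_inv:
  assumes "iso_map f G H"
  shows "iso_map (inv_into (verts G) f) H G"
proof -
  have b: "bij_betw f (verts G) (verts H)" using assms by (simp add: iso_map_def)
  have "inv_into (verts G) f u \<in> verts G" "f (inv_into (verts G) f u) = u" if "u \<in> verts H" for u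
    using b that by (metis bij_betw_imp_surj_on inv_into_into, metis bij_betw_inv_into_right)
  then show ?thesis using assms b bij_betw_inv_into[OF b] unfolding iso_map_def by metis
qed

lemma graph_iso_refl: "graph_iso G G"
  using iso_map_id graph_iso_iff by blast

lemma graph_iso_sym: "graph_iso G H \<Longrightarrow> graph_iso H G"
  unfolding graph_iso_iff using iso_map_inv by blast

lemma graph_iso_trans: "graph_iso G H \<Longrightarrow> graph_iso H K \<Longrightarrow> graph_iso G K"
  unfolding graph_iso_iff using iso_map_comp by blast

lemma verts_delete_edge [simp]: "verts (delete_edge G e) = verts G"
  and edges_delete_edge [simp]: "edges (delete_edge G e) = edges G - {e}"
  and verts_add_edge [simp]: "verts (add_edge G e) = verts G"
  and edges_add_edge [simp]: "edges (add_edge G e) = insert e (edges G)"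
  by (simp_all add: delete_edge_def add_edge_def)

lemma in_nbrs: "y \<in> nbrs G x \<longleftrightarrow> {x, y} \<in> edges G"
  by (simp add: nbrs_def)

lemma nbrs_sym: "y \<in> nbrs G x \<longleftrightarrow> x \<in> nbrs G y"
  by (simp add: nbrs_def insert_commute)

lemma nbrs_delete_edge:
  "nbrs (delete_edge G {a, b}) x = nbrs G x - ((if x = a then {b} else {}) \<union> (if x = b then {a} else {}))"
  by (auto simp: nbrs_def doubleton_eq_iff)

lemma nbrs_add_edge:
  "nbrs (add_edge G {a, b}) x = nbrs G x \<union> (if x = a then {b} else {}) \<union> (if x = b then {a} else {})"
  by (auto simp: nbrs_def doubleton_eq_iff)

lemma simple_nbrs: "simple_graph G \<Longrightarrow> nbrs G x \<subseteq> verts G"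
  by (auto simp: simple_graph_def nbrs_def)

lemma simple_finite_nbrs: "simple_graph G \<Longrightarrow> finite (nbrs G x)"
  by (meson finite_subset simple_graph_def simple_nbrs)

lemma simple_finite_edges: "simple_graph G \<Longrightarrow> finite (edges G)"
  by (rule finite_subset[of _ "Pow (verts G)"]) (auto simp: simple_graph_def)

lemma simple_edgeE:
  assumes "simple_graph G" "e \<in> edges G"
  obtains a b where "e = {a, b}" "a \<noteq> b" "a \<in> verts G" "b \<in> verts G"
  using assms unfolding simple_graph_def by (metis card_2_iff insert_subset)

lemma simple_delete_edge: "simple_graph G \<Longrightarrow> simple_graph (delete_edge G e)"
  by (auto simp: simple_graph_def)

lemma simple_add_edge:
  "simple_graph G \<Longrightarrow> a \<in> verts G \<Longrightarrow> b \<in> verts G \<Longrightarrow> a \<noteq> b \<Longrightarrow> simple_graph (add_edge G {a, b})"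
  by (auto simp: simple_graph_def)

lemma add_delete_edge: "e \<in> edges G \<Longrightarrow> add_edge (delete_edge G e) e = G"
  by (simp add: add_edge_def delete_edge_def insert_absorb)

lemma delete_add_edge: "e \<notin> edges G \<Longrightarrow> delete_edge (add_edge G e) e = G"
  by (simp add: add_edge_def delete_edge_def)

lemma iso_map_nbrs:
  assumes f: "iso_map f G H" and "simple_graph G" "simple_graph H" "x \<in> verts G"
  shows "nbrs H (f x) = f ` nbrs G x"
proof -
  have b: "f ` verts G = verts H" using f by (simp add: iso_map_def bij_betw_def)
  have "y \<in> f ` nbrs G x" if "y \<in> nbrs H (f x)" for y
  proof -
    have "y \<in> verts H" using that simple_nbrs[OF assms(3)] by blast
    then obtain z where "z \<in> verts G" "y = f z" using b by blast
    then show ?thesis using that f assms(4) by (auto simp: iso_map_def in_nbrs)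
  qed
  moreover have "f y \<in> nbrs H (f x)" if "y \<in> nbrs G x" for y
  proof -
    have "y \<in> verts G" using that simple_nbrs[OF assms(2)] by blast
    then show ?thesis using that f assms(4) by (auto simp: iso_map_def in_nbrs)
  qed
  ultimately show ?thesis by blast
qed

lemma iso_map_card_nbrs:
  assumes f: "iso_map f G H" and "simple_graph G" "simple_graph H" "x \<in> verts G"
  shows "card (nbrs H (f x)) = card (nbrs G x)"
proof -
  have "inj_on f (nbrs G x)"
    using f simple_nbrs[OF assms(2)] by (auto simp: iso_map_def bij_betw_def intro: inj_on_subset)
  then show ?thesis by (simp add: iso_map_nbrs[OF assms] card_image)
qed

lemma iso_map_doubleton_eq:
  assumes "iso_map f G H" "{a, b, u, v} \<subseteq> verts G"
  shows "{f u, f v} = {f a, f b} \<longleftrightarrow> {u, v} = {a, b}"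
  using assms by (auto simp: iso_map_def bij_betw_def doubleton_eq_iff dest: inj_onD)

lemma iso_map_delete_edge:
  assumes "iso_map f G H" "a \<in> verts G" "b \<in> verts G"
  shows "iso_map f (delete_edge G {a, b}) (delete_edge H {f a, f b})"
  using assms iso_map_doubleton_eq[OF assms(1)] unfolding iso_map_def by simp

lemma iso_map_add_edge:
  assumes "iso_map f G H" "a \<in> verts G" "b \<in> verts G"
  shows "iso_map f (add_edge G {a, b}) (add_edge H {f a, f b})"
  using assms iso_map_doubleton_eq[OF assms(1)] unfolding iso_map_def by simp

section \<open>Edge degrees and the invariance of decks under isomorphism\<close>

lemma card_edges_at:
  assumes "simple_graph G"
  shows "card {g \<in> edges G. a \<in> g} = card (nbrs G a)"
proof -
  have "{g \<in> edges G. a \<in> g} = (\<lambda>y. {a, y}) ` nbrs G a"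
  proof -
    have "g \<in> (\<lambda>y. {a, y}) ` nbrs G a" if g: "g \<in> edges G" "a \<in> g" for g
    proof -
      obtain c d where "g = {c, d}" using simple_edgeE[OF assms g(1)] by blast
      then obtain y where "g = {a, y}" using g(2) by (auto simp: insert_commute)
      then show ?thesis using g(1) by (auto simp: in_nbrs)
    qed
    then show ?thesis by (auto simp: in_nbrs)
  qed
  moreover have "inj_on (\<lambda>y. {a, y}) (nbrs G a)"
    by (auto simp: inj_on_def doubleton_eq_iff)
  ultimately show ?thesis by (simp add: card_image)
qed

text \<open>An edge adjacent to \<open>{a, b}\<close> contains exactly one of \<open>a\<close> and
  \<open>b\<close>, as only \<open>{a, b}\<close> itself contains both. So the degree of an edge can
  be read off in its card, at the two vertices that the edge joined.\<close>

lemma edge_degree_eq: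
  assumes s: "simple_graph G" and ab: "{a, b} \<in> edges G"
  shows "edge_degree G {a, b} =
    card (nbrs (delete_edge G {a, b}) a) + card (nbrs (delete_edge G {a, b}) b)"
proof -
  let ?K = "delete_edge G {a, b}"
  have sK: "simple_graph ?K" by (rule simple_delete_edge[OF s])
  have ne: "a \<noteq> b" using assms by (auto simp: simple_graph_def)
  have "{f \<in> edges G. f \<noteq> {a, b} \<and> f \<inter> {a, b} \<noteq> {}} =
      {g \<in> edges ?K. a \<in> g} \<union> {g \<in> edges ?K. b \<in> g}" by auto
  moreover have "{g \<in> edges ?K. a \<in> g} \<inter> {g \<in> edges ?K. b \<in> g} = {}"
  proof -
    have False if "g \<in> edges G" "g \<noteq> {a, b}" "a \<in> g" "b \<in> g" for g
      using simple_edgeE[OF s that(1)] that ne by blast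
    then show ?thesis by auto
  qed
  ultimately show ?thesis
    unfolding edge_degree_def card_edges_at[OF sK, symmetric]
    using simple_finite_edges[OF sK] by (simp add: card_Un_disjoint)
qed

lemma unlabeled_eq:
  assumes "graph_iso G H" shows "unlabeled G = unlabeled H"
  using graph_iso_trans[OF assms] graph_iso_trans[OF graph_iso_sym[OF assms]]
  by (auto simp: unlabeled_def)

lemma iso_map_da_ecard:
  assumes f: "iso_map f G H" and s: "simple_graph G" "simple_graph H" and e: "e \<in> edges G"
  shows "f ` e \<in> edges H" and "da_ecard H (f ` e) = da_ecard G e"
proof -
  obtain a b where ab: "e = {a, b}" "a \<in> verts G" "b \<in> verts G"
    using simple_edgeE[OF s(1) e] by blast
  show m: "f ` e \<in> edges H" using f ab e by (auto simp: iso_map_def)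
  have i: "iso_map f (delete_edge G e) (delete_edge H (f ` e))"
    using iso_map_delete_edge[OF f ab(2,3)] ab(1) by simp
  have sK: "simple_graph (delete_edge G e)" "simple_graph (delete_edge H (f ` e))"
    using s simple_delete_edge by blast+
  have "edge_degree H (f ` e) = edge_degree G e"
    using edge_degree_eq[OF s(1), of a b] edge_degree_eq[OF s(2), of "f a" "f b"] ab e m
      iso_map_card_nbrs[OF i sK] by simp
  then show "da_ecard H (f ` e) = da_ecard G e"
    using unlabeled_eq i graph_iso_iff unfolding da_ecard_def by blast
qed

lemma iso_da_edeck:
  assumes "graph_iso G H" and s: "simple_graph G" "simple_graph H"
  shows "da_edeck G = da_edeck H"
proof -
  obtain f where f: "iso_map f G H" using assms graph_iso_iff by blast
  have inj: "inj_on f (verts G)" using f by (simp add: iso_map_def bij_betw_def)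
  have sub: "edges G \<subseteq> Pow (verts G)" using s by (auto simp: simple_graph_def)
  have "edges H = (`) f ` edges G"
  proof -
    have "e \<in> (`) f ` edges G" if "e \<in> edges H" for e
    proof -
      obtain a b where ab: "e = {a, b}" "a \<in> verts H" "b \<in> verts H"
        using simple_edgeE[OF s(2) \<open>e \<in> edges H\<close>] by metis
      have "verts H = f ` verts G" using f by (simp add: iso_map_def bij_betw_def)
      then obtain c d where "a = f c" "b = f d" "c \<in> verts G" "d \<in> verts G"
        using ab(2,3) by blast
      then have "e = f ` {c, d}" "{c, d} \<in> edges G"
        using ab that f by (auto simp: iso_map_def)
      then show ?thesis by blast
    qed
    then show ?thesis using iso_map_da_ecard(1)[OF f s(1,2)] by blast
  qed
  moreover have "inj_on ((`) f) (edges G)"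
    using inj_on_image_Pow[OF inj] sub by (rule inj_on_subset)
  ultimately have "mset_set (edges H) = image_mset ((`) f) (mset_set (edges G))"
    by (simp add: image_mset_mset_set)
  then show ?thesis unfolding da_edeck_def
    using iso_map_da_ecard(2)[OF f s] simple_finite_edges[OF s(1)]
    by (auto simp: multiset.map_comp intro!: image_mset_cong)
qed

lemma in_da_edeck:
  "simple_graph G \<Longrightarrow> c \<in># da_edeck G \<longleftrightarrow> (\<exists>e \<in> edges G. c = da_ecard G e)"
  by (auto simp: da_edeck_def simple_finite_edges)

text \<open>\<open>determines\<close> and \<open>unlabeled\<close> range over graphs on natural
  numbers; copies bring graphs on other vertex types there.\<close>

lemma nat_copy:
  assumes "simple_graph G"
  obtains H :: "nat ugraph" where "simple_graph H" "graph_iso H G"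
proof -
  obtain f :: "'a \<Rightarrow> nat" where inj: "inj_on f (verts G)"
    using assms finite_imp_inj_to_nat_seg unfolding simple_graph_def by metis
  let ?H = "\<lparr>verts = f ` verts G, edges = (`) f ` edges G\<rparr>"
  have sub: "e \<subseteq> verts G" "card e = 2" if "e \<in> edges G" for e
    using assms that by (auto simp: simple_graph_def)
  have "simple_graph ?H"
    using assms sub card_image[OF inj_on_subset[OF inj]] by (fastforce simp: simple_graph_def)
  moreover have "iso_map f G ?H"
  proof -
    have 1: "{u, v} \<in> edges G" if "{f u, f v} \<in> (`) f ` edges G" "u \<in> verts G" "v \<in> verts G" for u v
    proof -
      have "f ` {u, v} \<in> (`) f ` edges G" using that(1) by simp
      then obtain e where e: "f ` {u, v} = f ` e" "e \<in> edges G" by (rule imageE)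
      have "{u, v} = e"
        using inj_on_image_eq_iff[OF inj, of "{u, v}" e] that(2,3) e sub(1) by simp
      then show ?thesis using e by simp
    qed
    have 2: "{f u, f v} \<in> (`) f ` edges G" if "{u, v} \<in> edges G" for u v
      using imageI[OF that, of "(`) f"] by simp
    have "\<forall>u\<in>verts G. \<forall>v\<in>verts G. {u, v} \<in> edges G \<longleftrightarrow> {f u, f v} \<in> (`) f ` edges G"
    proof (intro ballI iffI)
      fix u v assume "u \<in> verts G" "v \<in> verts G" "{f u, f v} \<in> (`) f ` edges G"
      then show "{u, v} \<in> edges G" by (intro 1)
    qed (rule 2)
    then show ?thesis using inj by (simp add: iso_map_def bij_betw_def)
  qed
  then have "graph_iso ?H G" unfolding graph_iso_iff using iso_map_inv by blast
  ultimately show ?thesis by (rule that)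
qed

text \<open>The class of \<open>G - e\<close> contains a copy of \<open>G - e\<close> on the natural
  numbers. Equality puts this copy into the other class too, which links the two cards even if their
  vertex types differ.\<close>

lemma da_ecard_eqD:
  fixes G :: "'a ugraph" and H :: "'b ugraph"
  assumes s: "simple_graph G" "simple_graph H" and eq: "da_ecard G e = da_ecard H e'"
  shows "edge_degree G e = edge_degree H e'" "graph_iso (delete_edge G e) (delete_edge H e')"
proof -
  show "edge_degree G e = edge_degree H e'" using eq by (simp add: da_ecard_def)
  obtain K :: "nat ugraph" where K: "simple_graph K" "graph_iso K (delete_edge G e)"
    using nat_copy simple_delete_edge[OF s(1)] by blast
  then have "K \<in> unlabeled (delete_edge G e)" by (simp add: unlabeled_def graph_iso_sym)
  then have "K \<in> unlabeled (delete_edge H e')" using eq by (simp add: da_ecard_def)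
  then show "graph_iso (delete_edge G e) (delete_edge H e')"
    using graph_iso_trans[OF graph_iso_sym[OF K(2)]] graph_iso_sym
    by (auto simp: unlabeled_def)
qed

lemma ecard_in_edeck_isoE:
  assumes s: "simple_graph G" "simple_graph H" and c: "da_ecard G e \<in># da_edeck H"
  obtains f e' where "e' \<in> edges H" "edge_degree H e' = edge_degree G e"
    "iso_map f (delete_edge G e) (delete_edge H e')"
proof -
  obtain e' where e': "e' \<in> edges H" "da_ecard G e = da_ecard H e'"
    using c unfolding in_da_edeck[OF s(2)] by blast
  note * = da_ecard_eqD[OF s e'(2)]
  obtain f where "iso_map f (delete_edge G e) (delete_edge H e')"
    using *(2) unfolding graph_iso_iff by blast
  then show ?thesis using that[OF e'(1)] *(1) by simp
qed

lemma card_nbrs_delete_edge: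
  assumes "simple_graph G" "{a, b} \<in> edges G"
  shows "card (nbrs (delete_edge G {a, b}) x) = card (nbrs G x) - (if x = a \<or> x = b then 1 else 0)"
proof -
  have "a \<noteq> b" using assms by (auto simp: simple_graph_def)
  moreover have "b \<in> nbrs G a" "a \<in> nbrs G b" using assms(2) by (auto simp: in_nbrs insert_commute)
  ultimately show ?thesis
    using simple_finite_nbrs[OF assms(1)] by (auto simp: nbrs_delete_edge)
qed

lemma edge_degree_conv_nbrs:
  assumes "simple_graph G" "{a, b} \<in> edges G"
  shows "edge_degree G {a, b} = (card (nbrs G a) - 1) + (card (nbrs G b) - 1)"
  unfolding edge_degree_eq[OF assms] card_nbrs_delete_edge[OF assms] by simp

section \<open>Extensions of a card\<close>

definition extends :: "'a ugraph \<Rightarrow> nat \<Rightarrow> 'a \<Rightarrow> 'a \<Rightarrow> bool" where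
  "extends K d x y \<longleftrightarrow> x \<in> verts K \<and> y \<in> verts K \<and> x \<noteq> y \<and> y \<notin> nbrs K x \<and>
     card (nbrs K x) + card (nbrs K y) = d"

lemma extends_sym: "extends K d x y \<longleftrightarrow> extends K d y x"
  using nbrs_sym[of x K y] by (auto simp: extends_def)

text \<open>The card is isomorphic to some \<open>H - e'\<close>. The ends of \<open>e'\<close>,
  pulled back along the isomorphism, are the pair to be joined, and their degrees in the card add up
  to the degree of \<open>e'\<close>.\<close>

lemma ecard_in_edeckD:
  assumes s: "simple_graph G" "simple_graph H" and c: "da_ecard G e \<in># da_edeck H"
  obtains x y where "extends (delete_edge G e) (edge_degree G e) x y"
    "graph_iso H (add_edge (delete_edge G e) {x, y})"
proof -
  let ?K = "delete_edge G e"
  obtain f e' where e': "e' \<in> edges H" and *: "edge_degree H e' = edge_degree G e"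
    and f: "iso_map f ?K (delete_edge H e')"
    using ecard_in_edeck_isoE[OF s c] .
  obtain a b where ab: "e' = {a, b}" "a \<noteq> b" "a \<in> verts H" "b \<in> verts H"
    using simple_edgeE[OF s(2) e'] by blast
  have "verts H = f ` verts G" using f by (simp add: iso_map_def bij_betw_def)
  then obtain x y where xy: "a = f x" "b = f y" "x \<in> verts G" "y \<in> verts G"
    using ab(3,4) by blast
  have sK: "simple_graph ?K" "simple_graph (delete_edge H e')" using s simple_delete_edge by auto
  have "edge_degree G e = card (nbrs ?K x) + card (nbrs ?K y)"
    using edge_degree_eq[OF s(2), of a b] e' ab(1) * iso_map_card_nbrs[OF f sK] xy by simp
  moreover have "y \<notin> nbrs ?K x"
  proof
    assume "y \<in> nbrs ?K x"
    then have "b \<in> nbrs (delete_edge H e') a" using iso_map_nbrs[OF f sK] xy by auto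
    then show False by (simp add: in_nbrs ab)
  qed
  ultimately have "extends ?K (edge_degree G e) x y" using ab xy by (auto simp: extends_def)
  moreover have "graph_iso H (add_edge ?K {x, y})"
  proof -
    have "iso_map f (add_edge ?K {x, y}) (add_edge (delete_edge H e') {a, b})"
      using iso_map_add_edge[OF f] xy by simp
    then have "iso_map f (add_edge ?K {x, y}) H" using ab e' by (simp add: add_delete_edge)
    then show ?thesis using graph_iso_iff graph_iso_sym by blast
  qed
  ultimately show ?thesis using that by blast
qed

lemma simple_extension:
  assumes "simple_graph G" "extends (delete_edge G e) d x y"
  shows "simple_graph (add_edge (delete_edge G e) {x, y})"
  using assms by (intro simple_add_edge simple_delete_edge) (auto simp: extends_def)

text \<open>The new edge is not an edge of the card, so deleting it gives the card back, and the
  degree sum in \<open>extends\<close> gives it the right degree.\<close>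

lemma ecard_in_edeckI:
  assumes s: "simple_graph G" and x: "extends (delete_edge G e) (edge_degree G e) x y"
  shows "da_ecard G e \<in># da_edeck (add_edge (delete_edge G e) {x, y})"
proof -
  let ?K = "delete_edge G e"
  let ?H = "add_edge ?K {x, y}"
  have sH: "simple_graph ?H" by (rule simple_extension[OF s x])
  have del: "delete_edge ?H {x, y} = ?K"
    using x by (intro delete_add_edge) (simp add: extends_def in_nbrs)
  have "edge_degree ?H {x, y} = edge_degree G e"
    using edge_degree_eq[OF sH, of x y] del x by (simp add: extends_def)
  then have "da_ecard ?H {x, y} = da_ecard G e" using del by (simp add: da_ecard_def)
  then show ?thesis unfolding in_da_edeck[OF sH] by (intro bexI[of _ "{x, y}"]) simp_all
qed

section \<open>Determining multisets and \<open>dern\<close>\<close>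

lemma determines_iso:
  assumes "graph_iso G H" "simple_graph G" "simple_graph H"
  shows "determines S G \<longleftrightarrow> determines S H"
proof -
  have "graph_iso K G \<longleftrightarrow> graph_iso K H" for K :: "nat ugraph"
    using graph_iso_trans[of K G H] graph_iso_trans[of K H G] graph_iso_sym[of G H] assms(1) by blast
  then show ?thesis unfolding determines_def iso_da_edeck[OF assms] by simp
qed

lemma dern_iso:
  assumes "graph_iso G H" "simple_graph G" "simple_graph H"
  shows "dern G = dern H"
  unfolding dern_def using determines_iso[OF assms] by simp

text \<open>A graph whose deck contains \<open>S\<close> has the card of \<open>e\<close> and is
  therefore an extension of it. Comparing the cards as sets is enough, because inclusion of
  multisets implies inclusion of their sets.\<close>

lemma determinesI:
  assumes s: "simple_graph G" and S: "S \<subseteq># da_edeck G" and e: "da_ecard G e \<in># S"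
    and *: "\<And>x y. extends (delete_edge G e) (edge_degree G e) x y \<Longrightarrow>
      set_mset S \<subseteq> set_mset (da_edeck (add_edge (delete_edge G e) {x, y})) \<Longrightarrow>
      graph_iso (add_edge (delete_edge G e) {x, y}) G"
  shows "determines S G"
proof -
  have "graph_iso H G" if H: "simple_graph H" "S \<subseteq># da_edeck H" for H :: "nat ugraph"
  proof -
    have "da_ecard G e \<in># da_edeck H" using H e by (meson mset_subset_eqD)
    then obtain x y where xy: "extends (delete_edge G e) (edge_degree G e) x y"
      "graph_iso H (add_edge (delete_edge G e) {x, y})"
      using ecard_in_edeckD[OF s H(1)] by blast
    have "da_edeck H = da_edeck (add_edge (delete_edge G e) {x, y})"
      using iso_da_edeck xy(2) H(1) simple_extension[OF s xy(1)] by blast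
    then have "graph_iso (add_edge (delete_edge G e) {x, y}) G"
      using *[OF xy(1)] H(2) set_mset_mono by metis
    then show ?thesis using xy(2) graph_iso_trans by blast
  qed
  then show ?thesis using S unfolding determines_def by blast
qed

lemma not_determines_single:
  assumes s: "simple_graph G" and x: "extends (delete_edge G e) (edge_degree G e) x y"
    and "\<not> graph_iso (add_edge (delete_edge G e) {x, y}) G"
  shows "\<not> determines {#da_ecard G e#} G"
proof -
  let ?H = "add_edge (delete_edge G e) {x, y}"
  have sH: "simple_graph ?H" by (rule simple_extension[OF s x])
  obtain H :: "nat ugraph" where H: "simple_graph H" "graph_iso H ?H"
    using nat_copy[OF sH] by blast
  have "da_edeck H = da_edeck ?H" using iso_da_edeck H sH by blast
  then have "{#da_ecard G e#} \<subseteq># da_edeck H" using ecard_in_edeckI[OF s x] by simp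
  moreover have "\<not> graph_iso H G"
    using assms(3) graph_iso_trans[OF graph_iso_sym[OF H(2)], of G] by blast
  ultimately show ?thesis using H(1) unfolding determines_def by blast
qed

text \<open>The graph without vertices is a rival whose deck contains \<open>{#}\<close>.\<close>

lemma not_determines_empty:
  assumes "verts G \<noteq> {}"
  shows "\<not> determines {#} G"
proof -
  have "simple_graph \<lparr>verts = {} :: nat set, edges = {}\<rparr>" by (simp add: simple_graph_def)
  moreover have "\<not> graph_iso \<lparr>verts = {} :: nat set, edges = {}\<rparr> G"
    using assms by (simp add: graph_iso_def bij_betw_def)
  ultimately show ?thesis unfolding determines_def by fastforce
qed

lemma dern_eq_1:
  assumes "verts G \<noteq> {}" "determines {#c#} G"
  shows "dern G = 1"
  unfolding dern_def
proof (rule Least_equality)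
  show "\<exists>S. determines S G \<and> size S = 1" using assms(2) by (intro exI[of _ "{#c#}"]) simp
  show "1 \<le> s" if "\<exists>S. determines S G \<and> size S = s" for s
    using that not_determines_empty[OF assms(1)] by (cases s) auto
qed

text \<open>A determining multiset is part of the deck of \<open>G\<close>, so one of size 1
  consists of a da-ecard of \<open>G\<close>.\<close>

lemma dern_eq_2:
  assumes s: "simple_graph G" and "verts G \<noteq> {}" "determines {#c, d#} G"
    and single: "\<And>e. e \<in> edges G \<Longrightarrow> \<not> determines {#da_ecard G e#} G"
  shows "dern G = 2"
  unfolding dern_def
proof (rule Least_equality)
  show "\<exists>S. determines S G \<and> size S = 2" using assms(3) by (intro exI[of _ "{#c, d#}"]) simp
  show "2 \<le> t" if t: "\<exists>S. determines S G \<and> size S = t" for t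
  proof (rule ccontr)
    assume less: "\<not> 2 \<le> t"
    obtain S where S: "determines S G" "size S = t" using t by blast
    then have "S \<noteq> {#}" using not_determines_empty[OF assms(2)] by blast
    then have "0 < size S" by (simp add: nonempty_has_size)
    then have "size S = 1" using S less by linarith
    then obtain a where a: "S = {#a#}" using size_1_singleton_mset by blast
    then have "a \<in># da_edeck G" using S by (simp add: determines_def)
    then obtain e where "e \<in> edges G" "a = da_ecard G e" unfolding in_da_edeck[OF s] by blast
    then show False using S(1) a single[of e] by simp
  qed
qed

lemma pair_subset_da_edeck:
  assumes "simple_graph G" "e \<in> edges G" "e' \<in> edges G" "e \<noteq> e'"
  shows "{#da_ecard G e, da_ecard G e'#} \<subseteq># da_edeck G"
proof -
  have "mset_set {e, e'} \<subseteq># mset_set (edges G)"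
    using assms simple_finite_edges by (intro subset_imp_msubset_mset_set) auto
  then have "image_mset (da_ecard G) (mset_set {e, e'}) \<subseteq># da_edeck G"
    unfolding da_edeck_def by (rule image_mset_subseteq_mono)
  then show ?thesis using assms(4) by simp
qed

text \<open>Twins are not adjacent, since otherwise each would be its own neighbour; hence
  exchanging them keeps all adjacencies.\<close>

lemma iso_map_swap_twins:
  assumes "simple_graph G" and p: "p \<in> verts G" "q \<in> verts G" and eq: "nbrs G p = nbrs G q"
  shows "iso_map (id(p := q, q := p)) G G"
proof -
  let ?f = "id(p := q, q := p)"
  have loop: "x \<notin> nbrs G x" for x using assms(1) by (auto simp: in_nbrs simple_graph_def)
  have mem: "x \<in> nbrs G p \<longleftrightarrow> x \<in> nbrs G q" "p \<in> nbrs G x \<longleftrightarrow> q \<in> nbrs G x" for x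
    using eq nbrs_sym[of p G x] nbrs_sym[of q G x] by auto
  have "v \<in> nbrs G u \<longleftrightarrow> ?f v \<in> nbrs G (?f u)" for u v
    using loop mem by auto
  moreover have "bij_betw ?f (verts G) (verts G)"
    by (rule bij_betw_byWitness[where f' = ?f]) (use p in auto)
  ultimately show ?thesis unfolding iso_map_def in_nbrs by blast
qed

section \<open>Brooms with equal hubs and equal paths\<close>

lemma path_vertex_eq_iff [simp]:
  "path_vertex k j l = HubU \<longleftrightarrow> l = 0"
  "path_vertex k j l = HubV \<longleftrightarrow> l \<noteq> 0 \<and> Suc l = k"
  "path_vertex k j l \<noteq> LeafU i" "path_vertex k j l \<noteq> LeafV i"
  "path_vertex k j l = Inner a b \<longleftrightarrow> l \<noteq> 0 \<and> Suc l \<noteq> k \<and> j = a \<and> l = b"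
  "HubU = path_vertex k j l \<longleftrightarrow> l = 0"
  "HubV = path_vertex k j l \<longleftrightarrow> l \<noteq> 0 \<and> Suc l = k"
  "LeafU i \<noteq> path_vertex k j l" "LeafV i \<noteq> path_vertex k j l"
  "Inner a b = path_vertex k j l \<longleftrightarrow> l \<noteq> 0 \<and> Suc l \<noteq> k \<and> j = a \<and> l = b"
  by (auto simp: path_vertex_def)

lemma path_vertex_0 [simp]: "path_vertex k j 0 = HubU"
  by simp

lemma path_vertex_Inner: "0 < l \<Longrightarrow> Suc l < k \<Longrightarrow> path_vertex k j l = Inner j l"
  by simp

locale equal_broom =
  fixes n m k :: nat
  assumes n: "1 \<le> n" and m: "2 \<le> m" and k: "3 \<le> k"
begin

abbreviation B :: "broom_vertex ugraph" where
  "B \<equiv> strong_double_broom n n [(m, k)]"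

section \<open>Vertices, edges and neighbourhoods of the broom\<close>

lemma verts_B: "verts B = {HubU, HubV} \<union> LeafU ` {..<n} \<union> LeafV ` {..<n} \<union>
    {Inner j l | j l. j < m \<and> 0 < l \<and> Suc l < k}"
proof -
  have "{path_vertex (replicate m k ! j) j l | j l. j < m \<and> l < replicate m k ! j} =
      {path_vertex k j l | j l. j < m \<and> l < k}" by force
  also have "\<dots> \<union> {HubU, HubV} = {HubU, HubV} \<union> {Inner j l | j l. j < m \<and> 0 < l \<and> Suc l < k}"
  proof -
    have "Inner j l \<in> {path_vertex k j l | j l. j < m \<and> l < k}" if "j < m" "0 < l" "Suc l < k" for j l
    proof -
      have "Inner j l = path_vertex k j l" "l < k" using that by simp_all
      then show ?thesis using that(1) by blast
    qed
    then have "{Inner j l | j l. j < m \<and> 0 < l \<and> Suc l < k} \<subseteq> {path_vertex k j l | j l. j < m \<and> l < k}"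
      by blast
    moreover have "{path_vertex k j l | j l. j < m \<and> l < k} \<subseteq>
        {HubU, HubV} \<union> {Inner j l | j l. j < m \<and> 0 < l \<and> Suc l < k}"
      by (auto simp: path_vertex_def)
    ultimately show ?thesis by auto
  qed
  finally show ?thesis by (auto simp: strong_double_broom_def broom_of_paths_def)
qed

lemma edges_B: "edges B = {{HubU, LeafU i} | i. i < n} \<union> {{HubV, LeafV i} | i. i < n} \<union>
    {{path_vertex k j l, path_vertex k j (Suc l)} | j l. j < m \<and> Suc l < k}"
proof -
  have "{{path_vertex (replicate m k ! j) j l, path_vertex (replicate m k ! j) j (Suc l)} | j l.
        j < m \<and> Suc l < replicate m k ! j} =
      {{path_vertex k j l, path_vertex k j (Suc l)} | j l. j < m \<and> Suc l < k}" by force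
  then show ?thesis by (simp add: strong_double_broom_def broom_of_paths_def)
qed

lemma in_verts_B [simp]:
  "HubU \<in> verts B" "HubV \<in> verts B" "LeafU i \<in> verts B \<longleftrightarrow> i < n" "LeafV i \<in> verts B \<longleftrightarrow> i < n"
  "Inner j l \<in> verts B \<longleftrightarrow> j < m \<and> 0 < l \<and> Suc l < k"
  by (auto simp: verts_B)

lemma path_vertex_in_verts: "j < m \<Longrightarrow> l < k \<Longrightarrow> path_vertex k j l \<in> verts B"
  by (auto simp: path_vertex_def)

lemma vertsE:
  assumes "x \<in> verts B"
  obtains "x = HubU" | "x = HubV" | i where "x = LeafU i" "i < n" | i where "x = LeafV i" "i < n"
    | j l where "x = Inner j l" "j < m" "0 < l" "Suc l < k"
  using assms by (cases x) auto

lemma simple_B: "simple_graph B"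
proof -
  have "{Inner j l | j l. j < m \<and> 0 < l \<and> Suc l < k} \<subseteq> (\<lambda>(j, l). Inner j l) ` ({..<m} \<times> {..<k})"
    by auto
  then have "finite {Inner j l | j l. j < m \<and> 0 < l \<and> Suc l < k}" by (rule finite_subset) simp
  then have "finite (verts B)" by (simp add: verts_B)
  moreover have "path_vertex k j l \<noteq> path_vertex k j (Suc l)" for j l
    by (auto simp: path_vertex_def)
  ultimately show ?thesis unfolding simple_graph_def edges_B
    by (auto simp: path_vertex_in_verts card_2_iff')
qed

lemma path_edge: "j < m \<Longrightarrow> Suc l < k \<Longrightarrow> {path_vertex k j l, path_vertex k j (Suc l)} \<in> edges B"
  unfolding edges_B by blast

lemma nbrs_HubU: "nbrs B HubU = LeafU ` {..<n} \<union> (\<lambda>j. Inner j 1) ` {..<m}"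
proof -
  have "Inner j 1 \<in> nbrs B HubU" if "j < m" for j
    using path_edge[OF that, of 0] k by (simp add: in_nbrs path_vertex_def)
  moreover have "LeafU i \<in> nbrs B HubU" if "i < n" for i
    using that by (auto simp: in_nbrs edges_B)
  moreover have "nbrs B HubU \<subseteq> LeafU ` {..<n} \<union> (\<lambda>j. Inner j 1) ` {..<m}"
    using k by (auto simp: nbrs_def edges_B doubleton_eq_iff path_vertex_def)
  ultimately show ?thesis by blast
qed

lemma nbrs_HubV: "nbrs B HubV = LeafV ` {..<n} \<union> (\<lambda>j. Inner j (k - 2)) ` {..<m}"
proof -
  \<comment> \<open>\<open>p\<close> is \<open>k - 3\<close>: \<open>HubV\<close> has position
    \<open>k - 1\<close>, so the last edge of a path starts at position \<open>Suc p\<close>, that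
    is \<open>k - 2\<close>.\<close>
  obtain p where p: "k = Suc (Suc (Suc p))" using k by (metis One_nat_def Suc_1 Suc_le_D numeral_3_eq_3 Suc_le_mono)
  have "Inner j (k - 2) \<in> nbrs B HubV" if "j < m" for j
    using path_edge[OF that, of "Suc p"] p by (simp add: in_nbrs path_vertex_def insert_commute)
  moreover have "LeafV i \<in> nbrs B HubV" if "i < n" for i
    using that by (auto simp: in_nbrs edges_B)
  moreover have "nbrs B HubV \<subseteq> LeafV ` {..<n} \<union> (\<lambda>j. Inner j (k - 2)) ` {..<m}"
    using k by (auto simp: nbrs_def edges_B doubleton_eq_iff path_vertex_def)
  ultimately show ?thesis by blast
qed

lemma nbrs_LeafU: "nbrs B (LeafU i) = (if i < n then {HubU} else {})"
  by (auto simp: nbrs_def edges_B doubleton_eq_iff)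

lemma nbrs_LeafV: "nbrs B (LeafV i) = (if i < n then {HubV} else {})"
  by (auto simp: nbrs_def edges_B doubleton_eq_iff)

lemma nbrs_Inner:
  assumes "j < m" "0 < l" "Suc l < k"
  shows "nbrs B (Inner j l) = {path_vertex k j (l - 1), path_vertex k j (Suc l)}"
proof -
  obtain p where p: "l = Suc p" using assms by (cases l) auto
  have "path_vertex k j p \<in> nbrs B (Inner j l)" "path_vertex k j (Suc l) \<in> nbrs B (Inner j l)"
    using path_edge[of j p] path_edge[of j l] assms p
    by (simp_all add: in_nbrs insert_commute path_vertex_Inner)
  moreover have "nbrs B (Inner j l) \<subseteq> {path_vertex k j p, path_vertex k j (Suc l)}"
    using p by (auto simp: nbrs_def edges_B doubleton_eq_iff)
  ultimately show ?thesis using p by auto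
qed

lemmas nbrs_B = nbrs_HubU nbrs_HubV nbrs_LeafU nbrs_LeafV nbrs_Inner

lemma card_nbrs_B:
  "card (nbrs B HubU) = n + m" "card (nbrs B HubV) = n + m"
  "i < n \<Longrightarrow> card (nbrs B (LeafU i)) = 1" "i < n \<Longrightarrow> card (nbrs B (LeafV i)) = 1"
  "j < m \<Longrightarrow> 0 < l \<Longrightarrow> Suc l < k \<Longrightarrow> card (nbrs B (Inner j l)) = 2"
proof -
  show "card (nbrs B HubU) = n + m" unfolding nbrs_B
    by (subst card_Un_disjoint) (auto simp: card_image inj_on_def)
  show "card (nbrs B HubV) = n + m" unfolding nbrs_B
    by (subst card_Un_disjoint) (auto simp: card_image inj_on_def)
  have "path_vertex k j (l - 1) \<noteq> path_vertex k j (Suc l)" if "0 < l" "Suc l < k"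
    using that by (auto simp: path_vertex_def)
  then show "j < m \<Longrightarrow> 0 < l \<Longrightarrow> Suc l < k \<Longrightarrow> card (nbrs B (Inner j l)) = 2"
    by (simp add: nbrs_Inner)
qed (simp_all add: nbrs_B)

lemma edges_pathE:
  assumes "e \<in> edges B"
  obtains i where "e = {HubU, LeafU i}" "i < n" | i where "e = {HubV, LeafV i}" "i < n"
    | j l where "e = {path_vertex k j l, path_vertex k j (Suc l)}" "j < m" "Suc l < k"
  using assms unfolding edges_B by (elim UnE CollectE exE conjE) (rule that; assumption)+

text \<open>The split is by the kind of the ends, on which the degree of an edge depends. A path
  meets \<open>HubU\<close> in its edge at position 0 and \<open>HubV\<close> in its edge at
  position \<open>k - 2\<close>; for \<open>k = 3\<close> these are its only edges.\<close>

lemma edgesE: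
  assumes "e \<in> edges B"
  obtains i where "e = {HubU, LeafU i}" "i < n" | i where "e = {HubV, LeafV i}" "i < n"
    | j where "e = {HubU, Inner j 1}" "j < m" | j where "e = {HubV, Inner j (k - 2)}" "j < m"
    | j l where "e = {Inner j l, Inner j (Suc l)}" "j < m" "0 < l" "Suc (Suc l) < k"
proof -
  from assms show ?thesis
  proof (cases rule: edges_pathE)
    case (3 j l)
    consider "l = 0" | "0 < l" "Suc (Suc l) < k" | "l = k - 2" "Suc (Suc l) = k" using 3(3) by linarith
    then show ?thesis
    proof cases
      case 1
      then show ?thesis using 3 k that(3) by (simp add: path_vertex_def)
    next
      case 2
      then show ?thesis using 3 that(5) by (simp add: path_vertex_def)
    next
      case 3
      have "e = {HubV, Inner j (k - 2)}"
        using 3 \<open>e = _\<close> k by (auto simp: path_vertex_def)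
      then show ?thesis using \<open>j < m\<close> that(4) by blast
    qed
  qed (rule that(1) that(2); assumption)+
qed

lemma edges_BI:
  "i < n \<Longrightarrow> {HubU, LeafU i} \<in> edges B" "j < m \<Longrightarrow> {HubU, Inner j 1} \<in> edges B"
  "j < m \<Longrightarrow> 0 < l \<Longrightarrow> Suc (Suc l) < k \<Longrightarrow> {Inner j l, Inner j (Suc l)} \<in> edges B"
  using k by (simp_all flip: in_nbrs add: nbrs_B)

section \<open>The symmetry that exchanges the hubs\<close>

primrec swap_hubs :: "broom_vertex \<Rightarrow> broom_vertex" where
  "swap_hubs HubU = HubV"
| "swap_hubs HubV = HubU"
| "swap_hubs (LeafU i) = LeafV i"
| "swap_hubs (LeafV i) = LeafU i"
| "swap_hubs (Inner j l) = Inner j (k - 1 - l)"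

text \<open>All paths are reversed: position \<open>l\<close> becomes \<open>k - 1 - l\<close>, so
  the edge that starts at \<open>l\<close> becomes the one that starts at
  \<open>k - 1 - Suc l\<close>.\<close>

lemma iso_map_swap_hubs: "iso_map swap_hubs B B"
proof -
  have mem: "swap_hubs x \<in> verts B" "swap_hubs (swap_hubs x) = x" if "x \<in> verts B" for x
    using that by (auto elim!: vertsE)
  have path: "swap_hubs (path_vertex k j l) = path_vertex k j (k - 1 - l)" if "l < k" for j l
    using that k by (auto simp: path_vertex_def)
  have edge: "{swap_hubs u, swap_hubs v} \<in> edges B" if "{u, v} \<in> edges B" for u v
  proof -
    have "swap_hubs ` e \<in> edges B" if "e \<in> edges B" for e
    proof -
      from that show ?thesis
      proof (cases rule: edges_pathE)
        case (3 j l)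
        let ?l = "k - 1 - Suc l"
        have "Suc ?l = k - 1 - l" using 3 by linarith
        then have "swap_hubs ` e = {path_vertex k j ?l, path_vertex k j (Suc ?l)}"
          using 3 by (auto simp: path)
        moreover have "Suc ?l < k" using 3 by linarith
        ultimately show ?thesis using path_edge[OF 3(2), of ?l] by simp
      qed (auto simp: edges_B)
    qed
    from this[OF that] show ?thesis by simp
  qed
  have "bij_betw swap_hubs (verts B) (verts B)"
    by (rule bij_betw_byWitness[where f' = swap_hubs]) (auto simp: mem)
  moreover have conv: "{u, v} \<in> edges B" if "{swap_hubs u, swap_hubs v} \<in> edges B" "u \<in> verts B" "v \<in> verts B" for u v
    using edge[OF that(1)] that(2,3) by (simp add: mem)
  ultimately show ?thesis unfolding iso_map_def by (intro conjI ballI iffI) (assumption | rule edge conv)+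
qed

lemma da_ecard_swap_hubs:
  assumes "i < n" "j < m"
  shows "da_ecard B {HubV, LeafV i} = da_ecard B {HubU, LeafU i}"
    "da_ecard B {HubV, Inner j (k - 2)} = da_ecard B {HubU, Inner j 1}"
proof -
  have "swap_hubs ` {HubU, Inner j 1} = {HubV, Inner j (k - 2)}" by (simp add: numeral_2_eq_2)
  then show "da_ecard B {HubV, Inner j (k - 2)} = da_ecard B {HubU, Inner j 1}"
    using iso_map_da_ecard(2)[OF iso_map_swap_hubs simple_B simple_B edges_BI(2)] assms by metis
  have "swap_hubs ` {HubU, LeafU i} = {HubV, LeafV i}" by simp
  then show "da_ecard B {HubV, LeafV i} = da_ecard B {HubU, LeafU i}"
    using iso_map_da_ecard(2)[OF iso_map_swap_hubs simple_B simple_B edges_BI(1)] assms by metis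
qed

section \<open>Isomorphism invariants of the broom\<close>

lemma nbrs_B_nonempty: "x \<in> verts B \<Longrightarrow> nbrs B x \<noteq> {}"
  using n by (auto elim!: vertsE simp: nbrs_B lessThan_empty_iff)

text \<open>Only leaves have degree 1: inner vertices have degree 2 and hubs \<open>n + m\<close>,
  which is at least 3.\<close>

lemma nbrs_B_single:
  assumes "nbrs B x = {y}" shows "y = HubU \<or> y = HubV"
proof -
  have "x \<in> verts B" using assms simple_nbrs[OF simple_B, of y] nbrs_sym[of y B x] by blast
  then show ?thesis
  proof (cases rule: vertsE)
    case (5 j l)
    then have "card (nbrs B x) = 2" by (simp add: card_nbrs_B)
    then show ?thesis using assms by simp
  qed (use assms card_nbrs_B(1,2) n m in \<open>auto simp: nbrs_LeafU nbrs_LeafV\<close>)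
qed

text \<open>Every vertex of a triangle would be a hub, since a leaf has one neighbour and the two
  neighbours of an inner vertex are not adjacent. But the hubs are not adjacent to each other,
  because \<open>k\<close> is at least 3.\<close>

lemma no_triangle_B:
  assumes "y \<in> nbrs B x" "z \<in> nbrs B y" "x \<in> nbrs B z"
  shows False
proof -
  have hub: "x = HubU \<or> x = HubV" if xyz: "y \<in> nbrs B x" "z \<in> nbrs B x" "z \<in> nbrs B y" for x y z
  proof -
    have ne: "y \<noteq> z" using xyz(3) simple_B by (auto simp: in_nbrs simple_graph_def)
    have "x \<in> verts B" using xyz(1) simple_nbrs[OF simple_B, of y] nbrs_sym[of y B x] by blast
    then show ?thesis
    proof (cases rule: vertsE)
      case (5 j l)
      have "path_vertex k j (Suc l) \<in> nbrs B (path_vertex k j (l - 1))"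
        using xyz ne 5 nbrs_sym[of y B z] by (auto simp: nbrs_Inner)
      moreover have "path_vertex k j (l - 1) = HubU \<or> path_vertex k j (l - 1) = Inner j (l - 1) \<and> 0 < l - 1"
        using 5 by (auto simp: path_vertex_def)
      ultimately show ?thesis using 5 by (auto simp: nbrs_HubU nbrs_Inner path_vertex_def split: if_splits)
    qed (use xyz ne in \<open>auto simp: nbrs_B\<close>)
  qed
  have "z \<in> nbrs B x" "x \<in> nbrs B y" using assms nbrs_sym[of x B] by blast+
  then have "x = HubU \<or> x = HubV" "y = HubU \<or> y = HubV"
    using hub[of y x z] hub[of z y x] assms by blast+
  then show False using assms(1) by (auto simp: nbrs_B)
qed

text \<open>Each wrong extension used below against a single card violates one of these invariants.
  The last two hold since leaves hang only at hubs, which have degree \<open>n + m\<close> and are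
  not adjacent.\<close>

lemma graph_iso_B_props:
  assumes "graph_iso H B" and s: "simple_graph H"
  shows "x \<in> verts H \<Longrightarrow> nbrs H x \<noteq> {}"
    and "y \<in> nbrs H x \<Longrightarrow> z \<in> nbrs H y \<Longrightarrow> x \<notin> nbrs H z"
    and "nbrs H x = {y} \<Longrightarrow> card (nbrs H y) \<noteq> 2"
    and "nbrs H x = {y} \<Longrightarrow> nbrs H x' = {y'} \<Longrightarrow> y' \<notin> nbrs H y"
proof -
  obtain f where f: "iso_map f H B" using assms(1) unfolding graph_iso_iff by blast
  have v: "x \<in> verts H" if "y \<in> nbrs H x" for x y
    using that simple_nbrs[OF s, of y] nbrs_sym[of y H x] by blast
  have fn: "nbrs B (f x) = f ` nbrs H x" if "x \<in> verts H" for x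
    using iso_map_nbrs[OF f s simple_B that] .
  have single: "nbrs B (f x) = {f y}" "y \<in> verts H" if "nbrs H x = {y}" for x y
    using that fn[of x] v[of y x] simple_nbrs[OF s, of x] by auto
  show "nbrs H x \<noteq> {}" if "x \<in> verts H"
    using nbrs_B_nonempty[of "f x"] fn[OF that] f that by (auto simp: iso_map_def bij_betw_def)
  show "x \<notin> nbrs H z" if "y \<in> nbrs H x" "z \<in> nbrs H y"
  proof
    assume xz: "x \<in> nbrs H z"
    have "f y \<in> nbrs B (f x)" "f z \<in> nbrs B (f y)" "f x \<in> nbrs B (f z)"
      using that xz fn v by auto
    then show False by (rule no_triangle_B)
  qed
  show "card (nbrs H y) \<noteq> 2" if "nbrs H x = {y}"
    using nbrs_B_single[OF single(1)[OF that]] card_nbrs_B(1,2) n m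
      iso_map_card_nbrs[OF f s simple_B single(2)[OF that]] by auto
  show "y' \<notin> nbrs H y" if "nbrs H x = {y}" "nbrs H x' = {y'}"
  proof
    assume "y' \<in> nbrs H y"
    then have "f y' \<in> nbrs B (f y)" using fn v by auto
    moreover have "f y \<in> {HubU, HubV}" "f y' \<in> {HubU, HubV}"
      using nbrs_B_single single(1) that by blast+
    ultimately show False by (auto simp: nbrs_B)
  qed
qed

section \<open>Cards that do not determine a broom\<close>

lemma not_determines_single_B:
  assumes x: "extends (delete_edge B e) (edge_degree B e) x y"
    and H: "H = add_edge (delete_edge B e) {x, y}"
    and "(\<exists>v \<in> verts B. nbrs H v = {}) \<or>
      (\<exists>a b c. b \<in> nbrs H a \<and> c \<in> nbrs H b \<and> a \<in> nbrs H c) \<or>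
      (\<exists>a b. nbrs H a = {b} \<and> card (nbrs H b) = 2) \<or>
      (\<exists>a b a' b'. nbrs H a = {b} \<and> nbrs H a' = {b'} \<and> b' \<in> nbrs H b)"
  shows "\<not> determines {#da_ecard B e#} B"
proof (rule not_determines_single[OF simple_B x], rule notI)
  assume "graph_iso (add_edge (delete_edge B e) {x, y}) B"
  then have "graph_iso H B" "simple_graph H" using H simple_extension[OF simple_B x] by simp_all
  note * = graph_iso_B_props[OF this]
  have "verts H = verts B" using H by simp
  then show False using assms(3) *(1) *(2) *(3) *(4) by metis
qed

lemma edge_degree_B:
  "i < n \<Longrightarrow> edge_degree B {HubU, LeafU i} = n + m - 1"
  "j < m \<Longrightarrow> edge_degree B {HubU, Inner j 1} = n + m"
  "j < m \<Longrightarrow> 0 < l \<Longrightarrow> Suc (Suc l) < k \<Longrightarrow> edge_degree B {Inner j l, Inner j (Suc l)} = 2"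
  using n m k edge_degree_conv_nbrs[OF simple_B] edges_BI
  by (simp_all add: card_nbrs_B)

text \<open>Asking for nonadjacency in \<open>B\<close> rather than in the card leaves out the
  removed edge itself, which would only restore \<open>B\<close>. The subtractions turn degrees in
  \<open>B\<close> into degrees in the card.\<close>

lemma extends_B:
  assumes e: "{a, b} \<in> edges B" and "x \<in> verts B" "y \<in> verts B" "x \<noteq> y" "y \<notin> nbrs B x"
    and "card (nbrs B x) - (if x = a \<or> x = b then 1 else 0) +
      (card (nbrs B y) - (if y = a \<or> y = b then 1 else 0)) = edge_degree B {a, b}"
  shows "extends (delete_edge B {a, b}) (edge_degree B {a, b}) x y"
  using assms card_nbrs_delete_edge[OF simple_B e] by (auto simp: extends_def nbrs_delete_edge)

text \<open>In the card the degrees are 0 at \<open>LeafU i\<close>, 1 at the other leaves and 2 at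
  inner vertices. The required sum \<open>n + m - 1\<close> is 2, 3 or 4 and arises as 0 + 2, 1 + 2
  or 2 + 2, without restoring the removed edge. In the last two cases \<open>LeafU i\<close> stays
  isolated.\<close>

lemma not_determines_pendant:
  assumes i: "i < n" and small: "n + m \<le> 5"
  shows "\<not> determines {#da_ecard B {HubU, LeafU i}#} B"
proof -
  let ?K = "delete_edge B {HubU, LeafU i}"
  consider "n + m = 3" | "n + m = 4" | "n + m = 5" using n m small by linarith
  then show ?thesis
  proof cases
    case 1
    then have "i = 0" using n m i by linarith
    \<comment> \<open>\<open>Inner 0 (k - 2)\<close> is adjacent to \<open>HubV\<close>, which
      carries \<open>LeafV i\<close>: two leaves hang at adjacent vertices.\<close>
    let ?H = "add_edge ?K {LeafU i, Inner 0 (k - 2)}"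
    have "nbrs ?H (LeafU i) = {Inner 0 (k - 2)}" "nbrs ?H (LeafV i) = {HubV}"
      using i by (simp_all add: nbrs_add_edge nbrs_delete_edge nbrs_B)
    moreover have "HubV \<in> nbrs ?H (Inner 0 (k - 2))"
      using m by (subst nbrs_sym) (auto simp: nbrs_add_edge nbrs_delete_edge nbrs_B)
    moreover have "extends ?K (edge_degree B {HubU, LeafU i}) (LeafU i) (Inner 0 (k - 2))"
      using i m k 1 by (intro extends_B edges_BI) (auto simp: edge_degree_B card_nbrs_B nbrs_LeafU)
    ultimately show ?thesis by (intro not_determines_single_B[OF _ refl]) blast+
  next
    case 2
    let ?H = "add_edge ?K {LeafV 0, Inner 0 1}"
    have "nbrs ?H (LeafU i) = {}" using i by (simp add: nbrs_add_edge nbrs_delete_edge nbrs_B)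
    moreover have "extends ?K (edge_degree B {HubU, LeafU i}) (LeafV 0) (Inner 0 1)"
      using k i m n 2 by (intro extends_B edges_BI) (auto simp: edge_degree_B card_nbrs_B nbrs_B)
    ultimately show ?thesis using i by (intro not_determines_single_B[OF _ refl]) auto
  next
    case 3
    let ?H = "add_edge ?K {Inner 0 1, Inner 1 1}"
    have "nbrs ?H (LeafU i) = {}" using i by (simp add: nbrs_add_edge nbrs_delete_edge nbrs_B)
    moreover have "extends ?K (edge_degree B {HubU, LeafU i}) (Inner 0 1) (Inner 1 1)"
      using k i m n 3 by (intro extends_B edges_BI) (auto simp: edge_degree_B card_nbrs_B nbrs_B path_vertex_def)
    ultimately show ?thesis using i by (intro not_determines_single_B[OF _ refl]) auto
  qed
qed

text \<open>Joining \<open>HubU\<close> to a leaf of \<open>HubV\<close> also has degree sum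
  \<open>(n + m - 1) + 1\<close>. Then \<open>Inner j 1\<close> remains as a leaf at
  \<open>Inner j 2\<close>, which is an inner vertex of degree 2 because \<open>k\<close> is at
  least 4.\<close>

lemma not_determines_hub_edge:
  assumes j: "j < m" and k4: "4 \<le> k"
  shows "\<not> determines {#da_ecard B {HubU, Inner j 1}#} B"
proof -
  let ?K = "delete_edge B {HubU, Inner j 1}"
  let ?H = "add_edge ?K {HubU, LeafV 0}"
  have "nbrs ?H (Inner j 1) = {Inner j 2}"
    using j k4 by (auto simp: nbrs_add_edge nbrs_delete_edge nbrs_B path_vertex_def)
  moreover have "card (nbrs ?H (Inner j 2)) = 2"
    using j k4 card_nbrs_B(5)[of j 2] by (simp add: nbrs_add_edge nbrs_delete_edge)
  moreover have "extends ?K (edge_degree B {HubU, Inner j 1}) HubU (LeafV 0)"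
    using n j by (intro extends_B edges_BI(2)) (auto simp only: edge_degree_B card_nbrs_B, auto simp: nbrs_B)
  ultimately show ?thesis by (intro not_determines_single_B[OF _ refl]) blast+
qed

text \<open>For \<open>k = 3\<close> all middle vertices are neighbours of \<open>HubV\<close>, so
  joining two neighbours of \<open>HubV\<close> makes a triangle. The sum 3 arises as 1 + 2 from
  \<open>LeafV 0\<close> and another middle vertex, the sum 4 as 2 + 2 from the two middle vertices
  off path \<open>j\<close>.\<close>

lemma not_determines_hub_edge_3:
  assumes j: "j < m" and k3: "k = 3" and nm: "n + m = 3 \<or> n = 1 \<and> m = 3"
  shows "\<not> determines {#da_ecard B {HubU, Inner j 1}#} B"
proof -
  let ?K = "delete_edge B {HubU, Inner j 1}"
  have triangle: ?thesis if "extends ?K (edge_degree B {HubU, Inner j 1}) x y"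
    "x \<in> nbrs B HubV" "y \<in> nbrs B HubV" "x \<noteq> y" for x y
  proof (rule not_determines_single_B[OF that(1) refl])
    let ?H = "add_edge ?K {x, y}"
    have "x \<in> nbrs ?H HubV" "HubV \<in> nbrs ?H y" "y \<in> nbrs ?H x"
      using that(2,3) nbrs_sym[of HubV B y] by (simp_all add: nbrs_add_edge nbrs_delete_edge)
    then show "(\<exists>v \<in> verts B. nbrs ?H v = {}) \<or>
      (\<exists>a b c. b \<in> nbrs ?H a \<and> c \<in> nbrs ?H b \<and> a \<in> nbrs ?H c) \<or>
      (\<exists>a b. nbrs ?H a = {b} \<and> card (nbrs ?H b) = 2) \<or>
      (\<exists>a b a' b'. nbrs ?H a = {b} \<and> nbrs ?H a' = {b'} \<and> b' \<in> nbrs ?H b)"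
      using nbrs_sym by metis
  qed
  have hub: "nbrs B HubV = LeafV ` {..<n} \<union> (\<lambda>j. Inner j 1) ` {..<m}"
    using nbrs_HubV k3 by simp
  from nm show ?thesis
  proof
    assume m2: "n + m = 3"
    \<comment> \<open>On a path other than \<open>j\<close> the middle vertex keeps degree
      2.\<close>
    obtain a where a: "a < m" "a \<noteq> j"
    proof -
      show ?thesis using that[of 0] that[of 1] m by (cases "j = 0") auto
    qed
    then have "extends ?K (edge_degree B {HubU, Inner j 1}) (LeafV 0) (Inner a 1)"
      using j k n m2 edge_degree_B(2)[OF j]
      by (intro extends_B edges_BI(2)) (auto simp: card_nbrs_B nbrs_LeafV)
    then show ?thesis using a n by (intro triangle[of "LeafV 0" "Inner a 1"]) (auto simp: hub)
  next
    assume m3: "n = 1 \<and> m = 3"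
    then have nm4: "n + m = 4" "2 < m" by simp_all
    obtain a b where ab: "a < m" "b < m" "a \<noteq> b" "a \<noteq> j" "b \<noteq> j"
    proof -
      have "j = 0 \<or> j = 1 \<or> j = 2" using j m3 by linarith
      then show ?thesis using that[of 1 2] that[of 0 2] that[of 0 1] nm4 by auto
    qed
    then have "extends ?K (edge_degree B {HubU, Inner j 1}) (Inner a 1) (Inner b 1)"
      using j k n nm4(1) edge_degree_B(2)[OF j]
      by (intro extends_B edges_BI(2)) (auto simp: card_nbrs_B nbrs_Inner path_vertex_def)
    then show ?thesis using ab by (intro triangle[of "Inner a 1" "Inner b 1"]) (auto simp: hub)
  qed
qed

text \<open>The required sum is 2, and both ends of the removed edge have degree 1 in the card, like
  the leaves. For \<open>l = 1\<close>, joining \<open>Inner j 1\<close> to a leaf of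
  \<open>HubU\<close> makes a triangle. Otherwise, joining \<open>Inner j (Suc l)\<close> to a leaf
  of \<open>HubV\<close> leaves \<open>Inner j l\<close> as a leaf at an inner vertex of degree
  2.\<close>

lemma not_determines_inner_edge:
  assumes j: "j < m" and l: "0 < l" "Suc (Suc l) < k"
  shows "\<not> determines {#da_ecard B {Inner j l, Inner j (Suc l)}#} B"
proof -
  let ?K = "delete_edge B {Inner j l, Inner j (Suc l)}"
  show ?thesis
  proof (cases "l = 1")
    case True
    let ?H = "add_edge ?K {LeafU 0, Inner j 1}"
    have "Inner j 1 \<in> nbrs ?H (LeafU 0)" "HubU \<in> nbrs ?H (Inner j 1)" "LeafU 0 \<in> nbrs ?H HubU"
      using True j l n by (simp_all add: nbrs_add_edge nbrs_delete_edge nbrs_B)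
    moreover have "extends ?K (edge_degree B {Inner j l, Inner j (Suc l)}) (LeafU 0) (Inner j 1)"
      using True n j l
      by (intro extends_B edges_BI(3)) (auto simp: edge_degree_B card_nbrs_B nbrs_LeafU)
    ultimately show ?thesis by (intro not_determines_single_B[OF _ refl]) blast+
  next
    case False
    then obtain p where p: "l = Suc p" "0 < p" using l by (cases l) auto
    let ?H = "add_edge ?K {LeafV 0, Inner j (Suc l)}"
    have "nbrs ?H (Inner j l) = {Inner j p}"
      using p j l by (auto simp: nbrs_add_edge nbrs_delete_edge nbrs_B path_vertex_def)
    moreover have "card (nbrs ?H (Inner j p)) = 2"
      using p j l card_nbrs_B(5)[of j p] by (simp add: nbrs_add_edge nbrs_delete_edge)
    moreover have "extends ?K (edge_degree B {Inner j l, Inner j (Suc l)}) (LeafV 0) (Inner j (Suc l))"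
      using n j l
      by (intro extends_B edges_BI(3)) (auto simp: edge_degree_B card_nbrs_B nbrs_LeafV)
    ultimately show ?thesis by (intro not_determines_single_B[OF _ refl]) blast+
  qed
qed

section \<open>Cards that determine a broom\<close>

text \<open>The sum \<open>n + m - 1\<close> is at least 5, which two vertices of degree at most 2
  cannot reach. \<open>HubV\<close> alone exceeds it, so \<open>HubU\<close> is one of the two, and
  the other has degree 0 and is \<open>LeafU 0\<close>.\<close>

lemma determines_pendant:
  assumes large: "6 \<le> n + m"
  shows "determines {#da_ecard B {HubU, LeafU 0}#} B"
proof (rule determinesI[OF simple_B])
  have e: "{HubU, LeafU 0} \<in> edges B" using n by (intro edges_BI) simp
  let ?K = "delete_edge B {HubU, LeafU 0}"
  show "{#da_ecard B {HubU, LeafU 0}#} \<subseteq># da_edeck B"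
    using e in_da_edeck[OF simple_B] by auto
  show "graph_iso (add_edge ?K {x, y}) B"
    if ext: "extends ?K (edge_degree B {HubU, LeafU 0}) x y" for x y
  proof -
    have v: "x \<in> verts B" "y \<in> verts B" "x \<noteq> y"
      and d: "card (nbrs ?K x) + card (nbrs ?K y) = n + m - 1"
      using ext n by (auto simp: extends_def edge_degree_B)
    have "x = HubU \<and> y = LeafU 0 \<or> x = LeafU 0 \<and> y = HubU"
      using v(1)
    proof (cases rule: vertsE)
    qed (use v(2,3) d large n m in \<open>auto elim!: vertsE simp: card_nbrs_delete_edge[OF simple_B e] card_nbrs_B split: if_splits\<close>)
    then have "{x, y} = {HubU, LeafU 0}" by auto
    then show ?thesis using add_delete_edge[OF e] graph_iso_refl by metis
  qed
qed simp

text \<open>\<open>HubV\<close> has degree \<open>n + m\<close> in the card and no vertex is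
  isolated, so \<open>HubV\<close> is excluded. Without \<open>HubU\<close>, two middle vertices of
  degree 2 would be needed. With \<open>HubU\<close>, the partner has degree 1 and is
  \<open>Inner 0 1\<close> or a leaf of \<open>HubV\<close>.\<close>

lemma determines_hub_edge:
  assumes k3: "k = 3" and large: "4 \<le> n + m" "(n, m) \<noteq> (1, 3)"
  shows "determines {#da_ecard B {HubU, Inner 0 1}#} B"
proof (rule determinesI[OF simple_B])
  have e: "{HubU, Inner 0 1} \<in> edges B" using m by (intro edges_BI) simp
  let ?K = "delete_edge B {HubU, Inner 0 1}"
  have sK: "simple_graph ?K" by (rule simple_delete_edge[OF simple_B])
  show "{#da_ecard B {HubU, Inner 0 1}#} \<subseteq># da_edeck B"
    using e in_da_edeck[OF simple_B] by auto
  have c: "card (nbrs ?K HubU) = n + m - 1" "card (nbrs ?K HubV) = n + m"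
    "i < n \<Longrightarrow> card (nbrs ?K (LeafU i)) = 1" "i < n \<Longrightarrow> card (nbrs ?K (LeafV i)) = 1"
    "j < m \<Longrightarrow> card (nbrs ?K (Inner j 1)) = (if j = 0 then 1 else 2)" for i j
    using k unfolding card_nbrs_delete_edge[OF simple_B e] by (simp_all add: card_nbrs_B)
  have vE: "x = HubU \<or> x = HubV \<or> (\<exists>i<n. x = LeafU i) \<or> (\<exists>i<n. x = LeafV i) \<or> (\<exists>j<m. x = Inner j 1)"
    if "x \<in> verts B" for x using that k3 by (elim vertsE) (auto simp: less_Suc_eq)
  have pos: "1 \<le> card (nbrs ?K x)" if "x \<in> verts B" for x
    using vE[OF that] c n m by auto
  have small: "card (nbrs ?K x) \<le> 2 \<and> (card (nbrs ?K x) = 2 \<longrightarrow> (\<exists>j<m. x = Inner j 1 \<and> j \<noteq> 0))"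
    if "x \<in> verts B" "x \<noteq> HubU" "x \<noteq> HubV" for x
    using vE[OF that(1)] that c by (auto split: if_splits)
  have *: "graph_iso (add_edge ?K {HubU, y}) B"
    if ext: "extends ?K (n + m) HubU y" for y
  proof -
    have y: "y \<in> verts B" "y \<noteq> HubU" "y \<notin> nbrs ?K HubU" and d: "card (nbrs ?K y) = 1"
      using ext c(1) n m by (auto simp: extends_def)
    have "y = Inner 0 1 \<or> (\<exists>i<n. y = LeafV i)"
      using vE[OF y(1)] y d c n m
      by (auto simp: nbrs_delete_edge nbrs_HubU split: if_splits)
    then show ?thesis
    proof
      assume "y = Inner 0 1"
      then show ?thesis using add_delete_edge[OF e] graph_iso_refl by metis
    next
      assume "\<exists>i<n. y = LeafV i"
      then obtain i where i: "i < n" "y = LeafV i" by blast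
      have pv: "path_vertex k 0 (Suc 1) = HubV" using k3 by simp
      have "nbrs B (Inner 0 1) = {path_vertex k 0 (1 - 1), path_vertex k 0 (Suc 1)}"
        by (rule nbrs_Inner) (use m k in auto)
      then have "nbrs B (Inner 0 1) = {HubU, HubV}" unfolding pv by simp
      moreover have "nbrs B (LeafV i) = {HubV}" using i(1) by (simp add: nbrs_LeafV)
      \<comment> \<open>Without its edge to \<open>HubU\<close>, \<open>Inner 0 1\<close> is just
        another leaf of \<open>HubV\<close>.\<close>
      ultimately have "nbrs ?K (LeafV i) = nbrs ?K (Inner 0 1)" by (simp add: nbrs_delete_edge)
      then have "iso_map (id(LeafV i := Inner 0 1, Inner 0 1 := LeafV i)) ?K ?K"
        using i k m by (intro iso_map_swap_twins[OF sK]) auto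
      from iso_map_add_edge[OF this, of HubU "LeafV i"]
      have "iso_map (id(LeafV i := Inner 0 1, Inner 0 1 := LeafV i))
          (add_edge ?K {HubU, LeafV i}) (add_edge ?K {HubU, Inner 0 1})"
        using i by simp
      then show ?thesis using i(2) unfolding add_delete_edge[OF e] graph_iso_iff by blast
    qed
  qed
  show "graph_iso (add_edge ?K {x, y}) B"
    if ext: "extends ?K (edge_degree B {HubU, Inner 0 1}) x y" for x y
  proof -
    have d: "edge_degree B {HubU, Inner 0 1} = n + m" using edge_degree_B(2) m by simp
    have v: "x \<in> verts B" "y \<in> verts B" "x \<noteq> y"
      and s: "card (nbrs ?K x) + card (nbrs ?K y) = n + m"
      using ext d by (auto simp: extends_def)
    have "x = HubU \<or> y = HubU"
    proof (rule ccontr)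
      assume "\<not> (x = HubU \<or> y = HubU)"
      moreover have "x \<noteq> HubV" "y \<noteq> HubV" using s c(2) pos[OF v(1)] pos[OF v(2)] by auto
      ultimately have *: "card (nbrs ?K x) = 2" "card (nbrs ?K y) = 2" "n + m = 4"
        using small[OF v(1)] small[OF v(2)] s large(1) by linarith+
      then obtain j j' where "x = Inner j 1" "y = Inner j' 1" "j < m" "j' < m" "j \<noteq> 0" "j' \<noteq> 0"
        using small[OF v(1)] small[OF v(2)] \<open>\<not> (x = HubU \<or> y = HubU)\<close> \<open>x \<noteq> HubV\<close> \<open>y \<noteq> HubV\<close> by blast
      \<comment> \<open>For \<open>n + m = 4\<close> and \<open>(n, m)\<close> other than
        \<open>(1, 3)\<close> there are two paths, so \<open>Inner 1 1\<close> is the only middle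
        vertex of degree 2 and \<open>x = y\<close>.\<close>
      moreover have "m \<le> 2" using *(3) large(2) n m by auto
      ultimately show False using v(3) by auto
    qed
    then show ?thesis
    proof
      assume "x = HubU"
      then show ?thesis using *[of y] ext d by simp
    next
      assume "y = HubU"
      then show ?thesis using *[of x] ext extends_sym[of ?K _ x y] d by (simp add: insert_commute)
    qed
  qed
qed simp

text \<open>For \<open>n = 1\<close> and \<open>m = 2\<close>, these are the wrong graphs that share the card of \<open>{HubU, LeafU 0}\<close>.\<close>
definition moved_leaf :: "nat \<Rightarrow> nat \<Rightarrow> broom_vertex ugraph" where
  "moved_leaf a b = add_edge (delete_edge B {HubU, LeafU 0}) {LeafU 0, Inner a b}"

text \<open>An extension of the pendant card that does not touch \<open>LeafU 0\<close> leaves it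
  isolated, which the card of \<open>e\<close> excludes. Otherwise \<open>LeafU 0\<close>, of degree
  0, is joined to a vertex of degree \<open>n + m - 1\<close>: this is \<open>HubU\<close>, or an
  inner vertex if \<open>n + m = 3\<close>.\<close>

lemma determines_pendant_and:
  assumes e: "e \<in> edges B" "e \<noteq> {HubU, LeafU 0}"
    and isolated: "\<And>x. x \<in> verts B \<Longrightarrow> nbrs (delete_edge B e) x \<noteq> {}"
    and moved: "\<And>a b. n = 1 \<Longrightarrow> m = 2 \<Longrightarrow> Inner a b \<in> verts B \<Longrightarrow>
      da_ecard B e \<notin># da_edeck (moved_leaf a b)"
  shows "determines {#da_ecard B {HubU, LeafU 0}, da_ecard B e#} B"
proof (rule determinesI[OF simple_B])
  have p: "{HubU, LeafU 0} \<in> edges B" using n by (intro edges_BI) simp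
  let ?K = "delete_edge B {HubU, LeafU 0}"
  show "{#da_ecard B {HubU, LeafU 0}, da_ecard B e#} \<subseteq># da_edeck B"
    using pair_subset_da_edeck[OF simple_B p e(1)] e(2) by metis
  have *: "graph_iso (add_edge ?K {LeafU 0, y}) B"
    if ext: "extends ?K (edge_degree B {HubU, LeafU 0}) (LeafU 0) y"
      and c: "da_ecard B e \<in># da_edeck (add_edge ?K {LeafU 0, y})" for y
  proof -
    note cK = card_nbrs_delete_edge[OF simple_B p]
    have y: "y \<in> verts B" "y \<noteq> LeafU 0" and d: "card (nbrs ?K y) = n + m - 1"
      using ext n by (auto simp: extends_def edge_degree_B cK card_nbrs_B)
    from y(1) show ?thesis
    proof (cases rule: vertsE)
      case 1
      then have "{LeafU 0, y} = {HubU, LeafU 0}" by auto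
      then show ?thesis using add_delete_edge[OF p] graph_iso_refl by metis
    next
      case (5 j l)
      then have "n + m = 3" using d by (simp add: cK card_nbrs_B)
      then have "n = 1" "m = 2" using n m by linarith+
      then show ?thesis using moved[of j l] c y(1) unfolding moved_leaf_def 5(1) by blast
    qed (use y d n m in \<open>auto simp: cK card_nbrs_B\<close>)
  qed
  show "graph_iso (add_edge ?K {x, y}) B"
    if ext: "extends ?K (edge_degree B {HubU, LeafU 0}) x y"
      and sub: "set_mset {#da_ecard B {HubU, LeafU 0}, da_ecard B e#} \<subseteq> set_mset (da_edeck (add_edge ?K {x, y}))"
    for x y
  proof -
    let ?H = "add_edge ?K {x, y}"
    have c: "da_ecard B e \<in># da_edeck ?H" using sub by simp
    have sH: "simple_graph ?H" by (rule simple_extension[OF simple_B ext])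
    obtain f e' where "e' \<in> edges ?H" "edge_degree ?H e' = edge_degree B e" and f: "iso_map f (delete_edge B e) (delete_edge ?H e')"
      using ecard_in_edeck_isoE[OF simple_B sH c] .
    have "x = LeafU 0 \<or> y = LeafU 0"
    proof (rule ccontr)
      assume "\<not> (x = LeafU 0 \<or> y = LeafU 0)"
      \<comment> \<open>A vertex isolated in \<open>?H\<close> is isolated in every card of
        \<open>?H\<close>.\<close>
      then have "nbrs ?H (LeafU 0) = {}" by (auto simp: nbrs_add_edge nbrs_delete_edge nbrs_LeafU)
      then have empty: "nbrs (delete_edge ?H e') (LeafU 0) = {}" by (auto simp: nbrs_def)
      have "f ` verts B = verts B" using f by (simp add: iso_map_def bij_betw_def)
      then obtain v where v: "v \<in> verts B" "LeafU 0 = f v" using n by (metis imageE in_verts_B(3) less_eq_Suc_le One_nat_def)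
      then have "f ` nbrs (delete_edge B e) v = {}"
        using iso_map_nbrs[OF f simple_delete_edge[OF simple_B] simple_delete_edge[OF sH], of v] empty by simp
      then show False using isolated[OF v(1)] by simp
    qed
    then show ?thesis
    proof
      assume "x = LeafU 0"
      then show ?thesis using *[of y] ext c by simp
    next
      assume "y = LeafU 0"
      then show ?thesis using *[of x] ext c extends_sym[of ?K _ x y] by (simp add: insert_commute)
    qed
  qed
qed simp

section \<open>The cycle of length \<open>2 * k - 2\<close> with one leaf at \<open>HubV\<close> and
  one at \<open>Inner a b\<close>\<close>

lemma nbrs_moved_leaf:
  assumes "n = 1" "m = 2" "Inner a b \<in> verts B"
  shows "nbrs (moved_leaf a b) (LeafU 0) = {Inner a b}"
    and "nbrs (moved_leaf a b) (LeafV 0) = {HubV}"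
    and "nbrs (moved_leaf a b) HubU = {Inner 0 1, Inner 1 1}"
    and "nbrs (moved_leaf a b) HubV = {LeafV 0, Inner 0 (k - 2), Inner 1 (k - 2)}"
    and "Inner c l \<in> verts B \<Longrightarrow> nbrs (moved_leaf a b) (Inner c l) =
      {path_vertex k c (l - 1), path_vertex k c (Suc l)} \<union> (if c = a \<and> l = b then {LeafU 0} else {})"
proof -
  have lt: "{..<n} = {0}" "{..<m} = {0, 1}" "0 < n" using assms(1,2) by auto
  show "nbrs (moved_leaf a b) (LeafU 0) = {Inner a b}"
    "nbrs (moved_leaf a b) (LeafV 0) = {HubV}"
    "nbrs (moved_leaf a b) HubU = {Inner 0 1, Inner 1 1}"
    "nbrs (moved_leaf a b) HubV = {LeafV 0, Inner 0 (k - 2), Inner 1 (k - 2)}"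
    unfolding moved_leaf_def by (auto simp: nbrs_add_edge nbrs_delete_edge nbrs_HubU nbrs_HubV nbrs_LeafU nbrs_LeafV lt)
  show "Inner c l \<in> verts B \<Longrightarrow> nbrs (moved_leaf a b) (Inner c l) =
      {path_vertex k c (l - 1), path_vertex k c (Suc l)} \<union> (if c = a \<and> l = b then {LeafU 0} else {})"
    unfolding moved_leaf_def by (auto simp: nbrs_add_edge nbrs_delete_edge nbrs_Inner)
qed

lemma simple_moved_leaf:
  assumes "Inner a b \<in> verts B"
  shows "simple_graph (moved_leaf a b)"
  unfolding moved_leaf_def using assms n
  by (intro simple_add_edge simple_delete_edge simple_B) auto

lemma moved_leaf_degree_3:
  assumes nm: "n = 1" "m = 2" and ab: "Inner a b \<in> verts B"
    and v: "v \<in> verts B" "3 \<le> card (nbrs (moved_leaf a b) v)"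
  shows "v = HubV \<or> v = Inner a b"
  using v(1)
proof (cases rule: vertsE)
  case (3 i)
  then show ?thesis using v(2) nm nbrs_moved_leaf(1)[OF nm ab] by simp
next
  case (4 i)
  then show ?thesis using v(2) nm nbrs_moved_leaf(2)[OF nm ab] by simp
next
  case (5 c l)
  then have "card (nbrs (moved_leaf a b) v) \<le> 2" if "v \<noteq> Inner a b"
    using that nbrs_moved_leaf(5)[OF nm ab, of c l] by (auto simp: card_insert_if)
  then show ?thesis using v(2) by fastforce
qed (use v(2) nbrs_moved_leaf(3)[OF nm ab] in auto)

text \<open>The path has to follow one of the two arcs from \<open>HubV\<close> to \<open>Inner a b\<close>. After \<open>k - 1\<close> steps
  this ends at \<open>HubU\<close>, the antipode of \<open>HubV\<close> on the cycle of length \<open>2 k - 2\<close>.\<close>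
lemma moved_leaf_path:
  assumes nm: "n = 1" "m = 2" and ab: "Inner a b \<in> verts B"
    and q: "q 0 = HubV" "q (k - 1) = Inner a b" "inj_on q {..<k}"
    and step: "\<And>l. Suc l < k \<Longrightarrow> q (Suc l) \<in> nbrs (moved_leaf a b) (q l)"
    and deg: "\<And>l. l < k \<Longrightarrow> 2 \<le> card (nbrs (moved_leaf a b) (q l))"
  shows False
proof -
  note N = nbrs_moved_leaf[OF nm ab]
  \<comment> \<open>Leaves have degree 1, so the degree condition keeps the path on the
    cycle.\<close>
  have leaf: "q l \<noteq> LeafU 0" "q l \<noteq> LeafV 0" if "l < k" for l
  proof -
    have "card (nbrs (moved_leaf a b) (LeafU 0)) = 1" "card (nbrs (moved_leaf a b) (LeafV 0)) = 1"
      unfolding N(1,2) by simp_all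
    then show "q l \<noteq> LeafU 0" "q l \<noteq> LeafV 0"
      using deg[OF that] by (metis numeral_le_one_iff semiring_norm(69))+
  qed
  have "q 1 \<in> {Inner 0 (k - 2), Inner 1 (k - 2)}"
    using step[of 0] q(1) N(4) leaf[of 1] k by auto
  then obtain c where c: "c < m" "q 1 = Inner c (k - 2)" using nm(2) by auto
  \<comment> \<open>The claim covers two consecutive vertices, because the next one is determined
    only together with the vertex to which injectivity forbids a return.\<close>
  have "q l = path_vertex k c (k - 1 - l) \<and> q (Suc l) = path_vertex k c (k - 1 - Suc l)" if "Suc l < k" for l
    using that
  proof (induction l)
    case 0
    then show ?case using q(1) c k by (auto simp: numeral_2_eq_2)
  next
    case (Suc l)
    define p where "p = k - 1 - Suc l"
    have p: "0 < p" "Suc p < k" "k - 1 - l = Suc p" "k - 1 - Suc (Suc l) = p - 1"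
      using Suc.prems by (simp_all add: p_def)
    have q': "q l = path_vertex k c (Suc p)" "q (Suc l) = Inner c p"
      using Suc p(1,2,3) by (auto simp flip: p_def)
    have "Inner c p \<in> verts B" using c p by simp
    then have "q (Suc (Suc l)) \<in> {path_vertex k c (p - 1), path_vertex k c (Suc p), LeafU 0}"
      using step[OF Suc.prems] N(5)[of c p] q'(2) by (auto split: if_splits)
    moreover have "q (Suc (Suc l)) \<noteq> q l"
      using inj_onD[OF q(3), of "Suc (Suc l)" l] Suc.prems by auto
    ultimately have "q (Suc (Suc l)) = path_vertex k c (p - 1)"
      using leaf(1)[OF Suc.prems] q'(1) by auto
    moreover have "q (Suc l) = path_vertex k c (k - 1 - Suc l)" using Suc by simp
    ultimately show ?case using p(4) by simp
  qed
  \<comment> \<open>For \<open>l = k - 2\<close> the second part of the claim is about position 0,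
    which is \<open>HubU\<close>.\<close>
  from this[of "k - 2"] have "q (k - 1) = HubU" using k by (simp add: Suc_diff_Suc numeral_2_eq_2)
  then show False using q(2) by simp
qed

text \<open>The card keeps path 1 intact, with hubs of degree at least 3 at its ends. In the moved
  graph its image would be a path on \<open>k\<close> vertices between the only two vertices of
  degree 3, which \<open>moved_leaf_path\<close> rules out.\<close>

lemma inner_ecard_notin_moved_leaf:
  assumes nm: "n = 1" "m = 2" and k4: "4 \<le> k" and ab: "Inner a b \<in> verts B"
  shows "da_ecard B {Inner 0 1, Inner 0 2} \<notin># da_edeck (moved_leaf a b)"
proof
  let ?H = "moved_leaf a b"
  let ?L = "delete_edge B {Inner 0 1, Inner 0 2}"
  have e: "{Inner 0 1, Inner 0 2} \<in> edges B" using edges_BI(3)[of 0 1] m k4 by (simp add: numeral_2_eq_2)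
  note cL = card_nbrs_delete_edge[OF simple_B e]
  have sH: "simple_graph ?H" by (rule simple_moved_leaf[OF ab])
  assume c: "da_ecard B {Inner 0 1, Inner 0 2} \<in># da_edeck ?H"
  obtain f e' where "e' \<in> edges ?H" "edge_degree ?H e' = edge_degree B {Inner 0 1, Inner 0 2}"
    and f: "iso_map f ?L (delete_edge ?H e')"
    using ecard_in_edeck_isoE[OF simple_B sH c] .
  have s: "simple_graph ?L" "simple_graph (delete_edge ?H e')"
    using simple_B sH simple_delete_edge by blast+
  have bij: "inj_on f (verts B)" "f ` verts B = verts B"
    using f by (auto simp: iso_map_def bij_betw_def moved_leaf_def)
  \<comment> \<open>\<open>f\<close> maps onto a spanning subgraph of \<open>?H\<close>, so it sends
    edges to edges of \<open>?H\<close> and does not lower degrees.\<close>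
  have sub: "nbrs (delete_edge ?H e') v \<subseteq> nbrs ?H v" for v by (auto simp: nbrs_def)
  have deg: "card (nbrs ?L v) \<le> card (nbrs ?H (f v))" if "v \<in> verts B" for v
    using iso_map_card_nbrs[OF f s, of v] that card_mono[OF simple_finite_nbrs[OF sH] sub, of "f v"] by simp
  have adj: "f v \<in> nbrs ?H (f u)" if "v \<in> nbrs ?L u" "u \<in> verts B" for u v
    using iso_map_nbrs[OF f s, of u] that sub[of "f u"] by auto
  have "3 \<le> card (nbrs ?L HubU)" "3 \<le> card (nbrs ?L HubV)"
    using n m unfolding cL card_nbrs_B by auto
  then have "3 \<le> card (nbrs ?H (f HubU))" "3 \<le> card (nbrs ?H (f HubV))"
    using deg[of HubU] deg[of HubV] by simp_all
  moreover have "f HubU \<in> verts B" "f HubV \<in> verts B" using bij(2) by auto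
  ultimately have "f HubU \<in> {HubV, Inner a b}" "f HubV \<in> {HubV, Inner a b}"
    using moved_leaf_degree_3[OF nm ab] by blast+
  moreover have "f HubU \<noteq> f HubV" using inj_onD[OF bij(1), of HubU HubV] by auto
  ultimately have ends: "f HubU = HubV \<and> f HubV = Inner a b \<or> f HubU = Inner a b \<and> f HubV = HubV"
    by auto
  define q where "q l = f (path_vertex k 1 l)" for l
  have pv: "path_vertex k 1 l \<in> verts B" if "l < k" for l
    using that nm(2) by (intro path_vertex_in_verts) auto
  have "inj_on (path_vertex k 1) {..<k}"
    by (auto simp: inj_on_def path_vertex_def split: if_splits)
  moreover have "inj_on f (path_vertex k 1 ` {..<k})"
    by (rule inj_on_subset[OF bij(1)]) (use pv in auto)
  ultimately have q_inj: "inj_on q {..<k}"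
    using comp_inj_on[of "path_vertex k 1" "{..<k}" f] unfolding q_def comp_def by blast
  have q_step: "q (Suc l) \<in> nbrs ?H (q l)" if "Suc l < k" for l
  proof -
    have "path_vertex k 1 (Suc l) \<in> nbrs B (path_vertex k 1 l)"
      using path_edge[OF _ that, of 1] nm(2) by (simp add: in_nbrs)
    then have "path_vertex k 1 (Suc l) \<in> nbrs ?L (path_vertex k 1 l)"
      by (auto simp: nbrs_delete_edge)
    then show ?thesis using adj pv that unfolding q_def by simp
  qed
  have q_step': "q l \<in> nbrs ?H (q (Suc l))" if "Suc l < k" for l
    using q_step[OF that] nbrs_sym[of "q l" ?H "q (Suc l)"] by simp
  have q_deg: "2 \<le> card (nbrs ?H (q l))" if "l < k" for l
  proof -
    have "2 \<le> card (nbrs ?L (path_vertex k 1 l))"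
    proof -
      consider "l = 0" | "0 < l" "Suc l = k" | "0 < l" "Suc l < k"
        using \<open>l < k\<close> by linarith
      then show ?thesis
      proof cases
        case 1
        then show ?thesis using n m card_nbrs_B(1) unfolding cL by simp
      next
        case 2
        then have pvl: "path_vertex k 1 l = HubV" by simp
        show ?thesis using n m card_nbrs_B(2) unfolding cL pvl by simp
      next
        case 3
        then have pvl: "path_vertex k 1 l = Inner 1 l" by simp
        show ?thesis using 3 m card_nbrs_B(5)[of 1 l] unfolding cL pvl by simp
      qed
    qed
    then show ?thesis using deg[OF pv[OF that]] by (simp add: q_def)
  qed
  from ends show False
  proof
    assume *: "f HubU = HubV \<and> f HubV = Inner a b"
    have "q 0 = HubV" "q (k - 1) = Inner a b" using * k by (simp_all add: q_def path_vertex_def)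
    then show False using moved_leaf_path[OF nm ab, of q] q_inj q_step q_deg by blast
  next
    assume *: "f HubU = Inner a b \<and> f HubV = HubV"
    \<comment> \<open>In this orientation the reversed path starts at \<open>HubV\<close>.\<close>
    let ?r = "\<lambda>l. q (k - 1 - l)"
    have "?r 0 = HubV" "?r (k - 1) = Inner a b" using * k by (simp_all add: q_def path_vertex_def)
    moreover have "inj_on ?r {..<k}"
      by (rule inj_onI) (use inj_onD[OF q_inj] in \<open>fastforce\<close>)
    moreover have "?r (Suc l) \<in> nbrs ?H (?r l)" if "Suc l < k" for l
      using q_step'[of "k - 1 - Suc l"] that by (simp add: Suc_diff_Suc)
    moreover have "2 \<le> card (nbrs ?H (?r l))" if "l < k" for l
      using q_deg[of "k - 1 - l"] that by simp
    ultimately show False using moved_leaf_path[OF nm ab, of ?r] by blast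
  qed
qed

text \<open>In the card, \<open>HubV\<close> has degree 3 and two neighbours of degree 1. The moved
  graph is a 4-cycle with leaves at two adjacent vertices, so a vertex of degree 3 has as neighbours
  a leaf, the other vertex of degree 3 and one of degree 2. Only the deletion of the cycle edge
  between the two vertices of degree 2 can produce the pattern, but that edge has degree 2 instead
  of 3.\<close>

lemma hub_ecard_notin_moved_leaf:
  assumes nm: "n = 1" "m = 2" and k3: "k = 3" and ab: "Inner a b \<in> verts B"
  shows "da_ecard B {HubU, Inner 0 1} \<notin># da_edeck (moved_leaf a b)"
proof
  let ?H = "moved_leaf a b"
  let ?L = "delete_edge B {HubU, Inner 0 1}"
  have e: "{HubU, Inner 0 1} \<in> edges B" using m by (intro edges_BI) simp
  note cL = card_nbrs_delete_edge[OF simple_B e]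
  have sH: "simple_graph ?H" by (rule simple_moved_leaf[OF ab])
  assume c: "da_ecard B {HubU, Inner 0 1} \<in># da_edeck ?H"
  obtain f e' where e': "e' \<in> edges ?H" and d: "edge_degree ?H e' = edge_degree B {HubU, Inner 0 1}"
    and f: "iso_map f ?L (delete_edge ?H e')"
    using ecard_in_edeck_isoE[OF simple_B sH c] .
  let ?M = "delete_edge ?H e'"
  have s: "simple_graph ?L" "simple_graph ?M"
    using simple_B sH simple_delete_edge by blast+
  have vH: "verts ?H = verts B" by (simp add: moved_leaf_def)
  have bij: "inj_on f (verts B)" "f ` verts B = verts B"
    using f vH by (auto simp: iso_map_def bij_betw_def)
  obtain x y where xy: "e' = {x, y}" "x \<noteq> y" "x \<in> verts B" "y \<in> verts B"
    using simple_edgeE[OF sH e'] unfolding vH by blast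
  have exy: "{x, y} \<in> edges ?H" using e' xy(1) by simp
  have cM: "card (nbrs ?M v) = card (nbrs ?H v) - (if v = x \<or> v = y then 1 else 0)" for v
    unfolding xy(1) by (rule card_nbrs_delete_edge[OF sH exy])
  \<comment> \<open>Images of \<open>HubV\<close> and of its two neighbours of degree 1 in the
    card.\<close>
  define w p r where "w = f HubV" and "p = f (LeafV 0)" and "r = f (Inner 0 1)"
  have in_B: "LeafV 0 \<in> verts B" "Inner 0 1 \<in> verts B" using n m k by auto
  have "LeafV 0 \<in> nbrs B HubV" "Inner 0 1 \<in> nbrs B HubV"
    using n m k3 unfolding nbrs_HubV by auto
  then have "LeafV 0 \<in> nbrs ?L HubV" "Inner 0 1 \<in> nbrs ?L HubV"
    by (auto simp: nbrs_delete_edge)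
  then have "p \<in> nbrs ?M w" "r \<in> nbrs ?M w"
    using iso_map_nbrs[OF f s, of HubV] by (auto simp: w_def p_def r_def)
  then have pr: "p \<in> nbrs ?H w" "r \<in> nbrs ?H w"
    by (auto simp: nbrs_def)
  have "p \<noteq> r" using inj_onD[OF bij(1), of "LeafV 0" "Inner 0 1"] in_B by (auto simp: p_def r_def)
  have nm3: "n + m = 3" using nm by simp
  have "card (nbrs ?L HubV) = 3" "card (nbrs ?L (LeafV 0)) = 1" "card (nbrs ?L (Inner 0 1)) = 1"
    using in_B nm3 unfolding cL by (simp_all add: card_nbrs_B)
  then have deg: "card (nbrs ?M p) = 1" "card (nbrs ?M r) = 1" "card (nbrs ?M w) = 3"
    using iso_map_card_nbrs[OF f s, of HubV] iso_map_card_nbrs[OF f s, of "LeafV 0"]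
      iso_map_card_nbrs[OF f s, of "Inner 0 1"] in_B
    by (simp_all add: w_def p_def r_def)
  have "a < m" "0 < b" "Suc b < k" using ab by auto
  then have b: "b = 1" using k3 by linarith
  \<comment> \<open>\<open>a'\<close> is the other of the two paths, so the 4-cycle is
    \<open>HubU\<close>, \<open>Inner a 1\<close>, \<open>HubV\<close>,
    \<open>Inner a' 1\<close>.\<close>
  define a' where "a' = 1 - a"
  have a: "a = 0 \<and> a' = 1 \<or> a = 1 \<and> a' = 0" using \<open>a < m\<close> nm(2) by (auto simp: a'_def)
  have mem: "Inner a' 1 \<in> verts B" using a m k by auto
  note N = nbrs_moved_leaf[OF nm ab]
  have NU: "nbrs ?H HubU = {Inner a 1, Inner a' 1}" using a N(3) by auto
  have NV: "nbrs ?H HubV = {LeafV 0, Inner a 1, Inner a' 1}" using a N(4) k3 by auto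
  have "path_vertex k i (Suc 1) = HubV" for i using k3 by simp
  then have Na: "nbrs ?H (Inner a 1) = {HubU, HubV, LeafU 0}" and Na': "nbrs ?H (Inner a' 1) = {HubU, HubV}"
    using a N(5)[of a 1] N(5)[OF mem] ab b by auto
  have D: "card (nbrs ?H HubU) = 2" "card (nbrs ?H HubV) = 3"
    "card (nbrs ?H (Inner a 1)) = 3" "card (nbrs ?H (Inner a' 1)) = 2"
    unfolding NU NV Na Na' using a by auto
  have not_e': "{x, y} \<noteq> {HubU, Inner a' 1}"
  proof
    assume *: "{x, y} = {HubU, Inner a' 1}"
    then have "edge_degree ?H e' = 2"
      using edge_degree_conv_nbrs[OF sH, of HubU "Inner a' 1"] exy xy(1) D by simp
    then show False using d edge_degree_B(2)[of 0] nm3 m by simp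
  qed
  have end_of_e': "\<exists>z'. {x, y} = {z, z'} \<and> z' \<in> nbrs ?H z" if "card (nbrs ?M z) \<noteq> card (nbrs ?H z)" for z
  proof -
    have "z = x \<or> z = y" using that cM[of z] by (auto split: if_splits)
    then show ?thesis using exy by (auto simp: in_nbrs insert_commute)
  qed
  have "w \<in> verts B" using bij(2) by (auto simp: w_def)
  moreover have "3 \<le> card (nbrs ?H w)" using deg(3) cM[of w] by linarith
  ultimately have w: "w = HubV \<or> w = Inner a 1" using moved_leaf_degree_3[OF nm ab] b by blast
  \<comment> \<open>\<open>w\<close> still has degree 3, the degree that it has in
    \<open>?H\<close>, so it is not an end of the deleted edge.\<close>
  then have w_e': "w \<noteq> x" "w \<noteq> y" using deg(3) cM[of w] D by (auto split: if_splits)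
  from w show False
  proof
    assume "w = HubV"
    \<comment> \<open>A vertex of degree 3 keeps degree at least 2 after one deletion.\<close>
    moreover have "p \<noteq> Inner a 1" "r \<noteq> Inner a 1" using deg(1,2) cM[of "Inner a 1"] D(3) by (auto split: if_splits)
    ultimately have "p = Inner a' 1 \<or> r = Inner a' 1" using pr NV \<open>p \<noteq> r\<close> by auto
    then have "card (nbrs ?M (Inner a' 1)) \<noteq> card (nbrs ?H (Inner a' 1))" using deg(1,2) D(4) by auto
    then obtain z' where z': "{x, y} = {Inner a' 1, z'}" "z' \<in> {HubU, HubV}"
      using end_of_e' Na' by metis
    then have "z' \<noteq> HubV" using w_e' \<open>w = HubV\<close> by auto
    then show False using z' not_e' by (simp add: insert_commute)
  next
    assume "w = Inner a 1"
    moreover have "p \<noteq> HubV" "r \<noteq> HubV" using deg(1,2) cM[of HubV] D(2) by (auto split: if_splits)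
    ultimately have "p = HubU \<or> r = HubU" using pr Na \<open>p \<noteq> r\<close> by auto
    then have "card (nbrs ?M HubU) \<noteq> card (nbrs ?H HubU)" using deg(1,2) D(1) by auto
    then obtain z' where z': "{x, y} = {HubU, z'}" "z' \<in> {Inner a 1, Inner a' 1}"
      using end_of_e' NU by metis
    then have "z' \<noteq> Inner a 1" using w_e' \<open>w = Inner a 1\<close> by auto
    then show False using z' not_e' by simp
  qed
qed

lemma determines_pendant_and_inner:
  assumes k4: "4 \<le> k"
  shows "determines {#da_ecard B {HubU, LeafU 0}, da_ecard B {Inner 0 1, Inner 0 2}#} B"
proof (rule determines_pendant_and)
  show e: "{Inner 0 1, Inner 0 2} \<in> edges B"
    using edges_BI(3)[of 0 1] m k4 by (simp add: numeral_2_eq_2)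
  show "{Inner 0 1, Inner 0 2} \<noteq> {HubU, LeafU 0}" by (simp add: doubleton_eq_iff)
  show "nbrs (delete_edge B {Inner 0 1, Inner 0 2}) x \<noteq> {}" if "x \<in> verts B" for x
  proof -
    have "card (nbrs (delete_edge B {Inner 0 1, Inner 0 2}) x) \<noteq> 0"
      using that unfolding card_nbrs_delete_edge[OF simple_B e]
      by (rule vertsE) (use n m in \<open>auto simp: card_nbrs_B\<close>)
    then show ?thesis by auto
  qed
qed (rule inner_ecard_notin_moved_leaf[OF _ _ k4])

lemma determines_pendant_and_hub:
  assumes k3: "k = 3"
  shows "determines {#da_ecard B {HubU, LeafU 0}, da_ecard B {HubU, Inner 0 1}#} B"
proof (rule determines_pendant_and)
  show e: "{HubU, Inner 0 1} \<in> edges B" using m by (intro edges_BI) simp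
  show "{HubU, Inner 0 1} \<noteq> {HubU, LeafU 0}" by (simp add: doubleton_eq_iff)
  show "nbrs (delete_edge B {HubU, Inner 0 1}) x \<noteq> {}" if "x \<in> verts B" for x
  proof -
    have "card (nbrs (delete_edge B {HubU, Inner 0 1}) x) \<noteq> 0"
      using that unfolding card_nbrs_delete_edge[OF simple_B e]
      by (rule vertsE) (use n m in \<open>auto simp: card_nbrs_B\<close>)
    then show ?thesis by auto
  qed
qed (rule hub_ecard_notin_moved_leaf[OF _ _ k3])

section \<open>The value of \<open>dern\<close>\<close>

lemma not_determines_single_edge:
  assumes e: "e \<in> edges B" and small: "n + m \<le> 5"
    and k: "4 \<le> k \<or> k = 3 \<and> (n + m = 3 \<or> n = 1 \<and> m = 3)"
  shows "\<not> determines {#da_ecard B e#} B"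
proof -
  have hub: "\<not> determines {#da_ecard B {HubU, Inner j 1}#} B" if "j < m" for j
    using not_determines_hub_edge[OF that] not_determines_hub_edge_3[OF that] k by blast
  from e show ?thesis
  proof (cases rule: edgesE)
    case (1 i)
    then show ?thesis using not_determines_pendant small by blast
  next
    case (2 i)
    \<comment> \<open>An edge at \<open>HubV\<close> has the same da-ecard as its mirror image at
      \<open>HubU\<close>.\<close>
    then show ?thesis using not_determines_pendant[of i] small da_ecard_swap_hubs(1)[of i 0] m by simp
  next
    case (3 j)
    then show ?thesis using hub by blast
  next
    case (4 j)
    then show ?thesis using hub[of j] da_ecard_swap_hubs(2)[of 0 j] n by simp
  next
    case (5 j l)
    then show ?thesis using not_determines_inner_edge by blast
  qed
qed

lemma dern_B:
  "dern B = (if n + m \<ge> 6 \<or> (n + m < 6 \<and> (n, m) \<noteq> (1, 2) \<and> (n, m) \<noteq> (1, 3) \<and> k = 3) then 1 else 2)"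
proof -
  have ne: "verts B \<noteq> {}" using in_verts_B(1) by blast
  \<comment> \<open>The three cases: a pendant card suffices, a hub edge card suffices, or no single
    card does.\<close>
  consider "6 \<le> n + m" | "n + m < 6" "k = 3" "4 \<le> n + m" "(n, m) \<noteq> (1, 3)"
    | "n + m \<le> 5" "4 \<le> k \<or> k = 3 \<and> (n + m = 3 \<or> n = 1 \<and> m = 3)"
    using k n m by fastforce
  then show ?thesis
  proof cases
    case 1
    then show ?thesis using dern_eq_1[OF ne determines_pendant] by simp
  next
    case 2
    then show ?thesis using dern_eq_1[OF ne determines_hub_edge] by auto
  next
    case 3
    \<comment> \<open>The partner of the pendant card is the card of an inner edge if
      \<open>k\<close> is at least 4; for \<open>k = 3\<close> there is no such edge and a hub edge
      takes its place.\<close>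
    have "\<exists>c d. determines {#c, d#} B"
      using 3(2) determines_pendant_and_inner determines_pendant_and_hub by blast
    then have "dern B = 2"
      using dern_eq_2[OF simple_B ne] not_determines_single_edge[OF _ 3] by blast
    moreover have "n + m = 3 \<longleftrightarrow> n = 1 \<and> m = 2" using n m by linarith
    ultimately show ?thesis using 3 by auto
  qed
qed

end

theorem theorem2p1:
  fixes G :: "'a ugraph" and n m k :: nat
  assumes "n \<ge> 1" and "m \<ge> 2" and "k \<ge> 3"
    and "simple_graph G" and "graph_iso G (strong_double_broom n n [(m, k)])"
  shows "dern G =
    (if n + m \<ge> 6 \<or> (n + m < 6 \<and> (n, m) \<noteq> (1, 2) \<and> (n, m) \<noteq> (1, 3) \<and> k = 3)
     then 1 else 2)"
proof -
  interpret equal_broom n m k using assms(1-3) by unfold_locales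
  show ?thesis using dern_iso[OF assms(5,4) simple_B] dern_B by simp
qed

end
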